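(* Let $F,G\in\operatorname{dom}(L)$ be such that $FG\in\operatorname{dom}(L)$ as well. Then $\Gamma_0(F,G)\in L^1(\mathbb{P})$ is well-defined and, in fact, $\Gamma(F,G)=\Gamma_0(F,G)$.
   Context: $\mathbb{N}=\{1,2,\ldots\}$. Let $(E_n,\mathcal{B}_n,\mu_n)$, $n\in\mathbb{N}$, be arbitrary probability spaces with product $(E,\mathcal{B},\mu)$. On a probability space $(\Omega,\mathcal{A},\mathbb{P})$ let $\mathbb{X}=(X_n)_{n\in\mathbb{N}}$ and $\mathbb{X}'=(X_n')_{n\in\mathbb{N}}$ be two independent $E$-valued random sequences, each with distribution $\mu$. For $k\in\mathbb{N}$, $\mathbb{X}^{(k)}$ denotes the sequence $\mathbb{X}$ with its $k$-th coordinate $X_k$ replaced by $X_k'$. Let $\mathcal{F}=\sigma(\mathbb{X})$, $\mathbb{P}_{\mathcal{F}}$ the restriction of $\mathbb{P}$ to $\mathcal{F}$, $L^2_{\mathbb{X}}=L^2(\Omega,\mathcal{F},\mathbb{P})$ (real-valued), $\kappa$ the counting measure on $\mathbb{N}$, and $\mathcal{G}_k=\sigma(X_j,j\neq k)$. A representative of $F\in L^2_{\mathbb{X}}$ is a function $f\in L^2(\mu)$ with $F=f(\mathbb{X})$ (it exists and is $\mu$-a.s. unique). Malliavin operators: for $F\in L^2_{\mathbb{X}}$, $D_kF:=F-\mathbb{E}[F\,|\,\mathcal{G}_k]$. On the dense subspace $\mathcal{S}\subseteq L^2_{\mathbb{X}}$ of random variables that are $\sigma(X_1,\dotsc,X_n)$-measurable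 for some $n$, define $DF:=(D_kF)_{k\in\mathbb{N}}\in L^2(\kappa\otimes\mathbb{P}_{\mathcal{F}})$. This operator is closable; its closure is again denoted by $D$, with domain $\operatorname{dom}(D)\subseteq L^2_{\mathbb{X}}$, and $DF=(D_kF)_{k\in\mathbb{N}}$ for all $F\in\operatorname{dom}(D)$. The divergence $\delta$ is the adjoint of $D$: $\operatorname{dom}(\delta)$ is the set of all $U=(U_k)_{k}\in L^2(\kappa\otimes\mathbb{P}_{\mathcal{F}})$ for which there is $C<\infty$ with $\bigl|\sum_{k=1}^\infty\mathbb{E}[D_kF\,U_k]\bigr|\leq C\|F\|_2$ for all $F\in\operatorname{dom}(D)$, and $\mathbb{E}[F\,\delta U]=\sum_{k=1}^\infty\mathbb{E}[D_kF\,U_k]$ for all such $F$. The Ornstein-Uhlenbeck generator $L$ has domain $\operatorname{dom}(L):=\{F\in\operatorname{dom}(D): DF\in\operatorname{dom}(\delta)\}$ and $LF:=-\delta DF$. Carré-du-champ operator: for $F,G\in\operatorname{dom}(L)$ with $FG\in\operatorname{dom}(L)$, $\Gamma(F,G):=\frac12\bigl(L(FG)-G\,LF-F\,LG\bigr)\in L^1(\mathbb{P})$. For $F,G\in\operatorname{dom}(D)$ with respective representatives $f,g\in L^2(\mu)$, $$\Gamma_0(F,G):=\frac12\sum_{k=1}^\infty\mathbb{E}\Bigl[\bigl(f(\mathbb{X}^{(k)})-f(\mathbb{X})\bigr)\bigl(g(\mathbb{X}^{(k)})-g(\mathbb{X})\bigr)\,\Big|\,\mathbb{X}\Bigr].$$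 *)

theory Defs
  imports "HOL-Probability.Probability"
begin

text \<open>
  The coordinate spaces are \<open>M n\<close> for \<open>n :: nat\<close>, so coordinates are counted from 0 rather
  than from 1.  Elements of \<open>L\<^sup>2\<close> are functions, not classes modulo null sets; operators whose
  values are only determined almost surely pick a version.
\<close>

definition sigma_coords ::
    "'w measure \<Rightarrow> (nat \<Rightarrow> 'a measure) \<Rightarrow> ('w \<Rightarrow> nat \<Rightarrow> 'a) \<Rightarrow> nat set \<Rightarrow> 'w measure" where
  "sigma_coords P M X J =
     sigma (space P) {(\<lambda>\<omega>. X \<omega> j) -` A \<inter> space P | j A. j \<in> J \<and> A \<in> sets (M j)}"

definition L2_space :: "'b measure \<Rightarrow> ('b \<Rightarrow> real) set" where
  "L2_space N = {f \<in> borel_measurable N. integrable N (\<lambda>x. (f x)\<^sup>2)}"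

definition L2_nrm :: "'b measure \<Rightarrow> ('b \<Rightarrow> real) \<Rightarrow> real" where
  "L2_nrm N f = sqrt (\<integral>x. (f x)\<^sup>2 \<partial>N)"

text \<open>The restriction of \<open>P\<close> to \<open>\<sigma>(X)\<close>.\<close>

definition P_F ::
    "'w measure \<Rightarrow> (nat \<Rightarrow> 'a measure) \<Rightarrow> ('w \<Rightarrow> nat \<Rightarrow> 'a) \<Rightarrow> 'w measure" where
  "P_F P M X = restr_to_subalg P (sigma_coords P M X UNIV)"

definition L2_X ::
    "'w measure \<Rightarrow> (nat \<Rightarrow> 'a measure) \<Rightarrow> ('w \<Rightarrow> nat \<Rightarrow> 'a) \<Rightarrow> ('w \<Rightarrow> real) set" where
  "L2_X P M X = L2_space (P_F P M X)"

definition kP ::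
    "'w measure \<Rightarrow> (nat \<Rightarrow> 'a measure) \<Rightarrow> ('w \<Rightarrow> nat \<Rightarrow> 'a) \<Rightarrow> (nat \<times> 'w) measure" where
  "kP P M X = count_space UNIV \<Otimes>\<^sub>M P_F P M X"

definition L2_proc ::
    "'w measure \<Rightarrow> (nat \<Rightarrow> 'a measure) \<Rightarrow> ('w \<Rightarrow> nat \<Rightarrow> 'a) \<Rightarrow> (nat \<Rightarrow> 'w \<Rightarrow> real) set" where
  "L2_proc P M X = {U. case_prod U \<in> L2_space (kP P M X)}"

definition mall_D ::
    "'w measure \<Rightarrow> (nat \<Rightarrow> 'a measure) \<Rightarrow> ('w \<Rightarrow> nat \<Rightarrow> 'a) \<Rightarrow>
     ('w \<Rightarrow> real) \<Rightarrow> nat \<Rightarrow> 'w \<Rightarrow> real" where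
  "mall_D P M X F k \<omega> = F \<omega> - real_cond_exp P (sigma_coords P M X (- {k})) F \<omega>"

definition cyl_S ::
    "'w measure \<Rightarrow> (nat \<Rightarrow> 'a measure) \<Rightarrow> ('w \<Rightarrow> nat \<Rightarrow> 'a) \<Rightarrow> ('w \<Rightarrow> real) set" where
  "cyl_S P M X =
     {F \<in> L2_X P M X. \<exists>n. F \<in> borel_measurable (sigma_coords P M X {..n})}"

text \<open>
  The domain of the closure of \<open>D\<close> on \<open>cyl_S\<close>: all \<open>F\<close> such that some \<open>(F, U)\<close> lies in the
  closure of the graph.  The closed operator itself is again given by \<open>mall_D\<close>.
\<close>

definition dom_D ::
    "'w measure \<Rightarrow> (nat \<Rightarrow> 'a measure) \<Rightarrow> ('w \<Rightarrow> nat \<Rightarrow> 'a) \<Rightarrow> ('w \<Rightarrow> real) set" where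
  "dom_D P M X =
     {F \<in> L2_X P M X. \<exists>U \<in> L2_proc P M X. \<exists>S.
        (\<forall>n. S n \<in> cyl_S P M X) \<and>
        (\<lambda>n. L2_nrm (P_F P M X) (\<lambda>\<omega>. S n \<omega> - F \<omega>)) \<longlonglongrightarrow> 0 \<and>
        (\<forall>n. mall_D P M X (S n) \<in> L2_proc P M X) \<and>
        (\<lambda>n. L2_nrm (kP P M X) (\<lambda>(k, \<omega>). mall_D P M X (S n) k \<omega> - U k \<omega>)) \<longlonglongrightarrow> 0}"

definition dual_pairing ::
    "'w measure \<Rightarrow> (nat \<Rightarrow> 'a measure) \<Rightarrow> ('w \<Rightarrow> nat \<Rightarrow> 'a) \<Rightarrow>
     ('w \<Rightarrow> real) \<Rightarrow> (nat \<Rightarrow> 'w \<Rightarrow> real) \<Rightarrow> real" where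
  "dual_pairing P M X F U = (\<Sum>k. \<integral>\<omega>. mall_D P M X F k \<omega> * U k \<omega> \<partial>P)"

definition dom_delta ::
    "'w measure \<Rightarrow> (nat \<Rightarrow> 'a measure) \<Rightarrow> ('w \<Rightarrow> nat \<Rightarrow> 'a) \<Rightarrow> (nat \<Rightarrow> 'w \<Rightarrow> real) set" where
  "dom_delta P M X =
     {U \<in> L2_proc P M X.
        \<exists>C. \<forall>F \<in> dom_D P M X. \<bar>dual_pairing P M X F U\<bar> \<le> C * L2_nrm P F}"

definition delta ::
    "'w measure \<Rightarrow> (nat \<Rightarrow> 'a measure) \<Rightarrow> ('w \<Rightarrow> nat \<Rightarrow> 'a) \<Rightarrow>
     (nat \<Rightarrow> 'w \<Rightarrow> real) \<Rightarrow> 'w \<Rightarrow> real" where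
  "delta P M X U =
     (SOME V. V \<in> L2_X P M X \<and>
        (\<forall>F \<in> dom_D P M X. (\<integral>\<omega>. F \<omega> * V \<omega> \<partial>P) = dual_pairing P M X F U))"

definition dom_L ::
    "'w measure \<Rightarrow> (nat \<Rightarrow> 'a measure) \<Rightarrow> ('w \<Rightarrow> nat \<Rightarrow> 'a) \<Rightarrow> ('w \<Rightarrow> real) set" where
  "dom_L P M X = {F \<in> dom_D P M X. mall_D P M X F \<in> dom_delta P M X}"

definition OU_L ::
    "'w measure \<Rightarrow> (nat \<Rightarrow> 'a measure) \<Rightarrow> ('w \<Rightarrow> nat \<Rightarrow> 'a) \<Rightarrow> ('w \<Rightarrow> real) \<Rightarrow> 'w \<Rightarrow> real" where
  "OU_L P M X F \<omega> = - delta P M X (mall_D P M X F) \<omega>"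

definition Gam ::
    "'w measure \<Rightarrow> (nat \<Rightarrow> 'a measure) \<Rightarrow> ('w \<Rightarrow> nat \<Rightarrow> 'a) \<Rightarrow>
     ('w \<Rightarrow> real) \<Rightarrow> ('w \<Rightarrow> real) \<Rightarrow> 'w \<Rightarrow> real" where
  "Gam P M X F G \<omega> =
     (OU_L P M X (\<lambda>\<omega>. F \<omega> * G \<omega>) \<omega> - G \<omega> * OU_L P M X F \<omega> - F \<omega> * OU_L P M X G \<omega>) / 2"

definition representative ::
    "'w measure \<Rightarrow> (nat \<Rightarrow> 'a measure) \<Rightarrow> ('w \<Rightarrow> nat \<Rightarrow> 'a) \<Rightarrow>
     ('w \<Rightarrow> real) \<Rightarrow> ((nat \<Rightarrow> 'a) \<Rightarrow> real) \<Rightarrow> bool" where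
  "representative P M X F f \<longleftrightarrow>
     f \<in> L2_space (\<Pi>\<^sub>M n\<in>UNIV. M n) \<and> (AE \<omega> in P. F \<omega> = f (X \<omega>))"

definition swap_prod ::
    "('w \<Rightarrow> nat \<Rightarrow> 'a) \<Rightarrow> ('w \<Rightarrow> nat \<Rightarrow> 'a) \<Rightarrow>
     ((nat \<Rightarrow> 'a) \<Rightarrow> real) \<Rightarrow> ((nat \<Rightarrow> 'a) \<Rightarrow> real) \<Rightarrow> nat \<Rightarrow> 'w \<Rightarrow> real" where
  "swap_prod X X' f g k \<omega> =
     (f ((X \<omega>)(k := X' \<omega> k)) - f (X \<omega>)) * (g ((X \<omega>)(k := X' \<omega> k)) - g (X \<omega>))"

definition Gam0_term ::
    "'w measure \<Rightarrow> (nat \<Rightarrow> 'a measure) \<Rightarrow> ('w \<Rightarrow> nat \<Rightarrow> 'a) \<Rightarrow> ('w \<Rightarrow> nat \<Rightarrow> 'a) \<Rightarrow>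
     ((nat \<Rightarrow> 'a) \<Rightarrow> real) \<Rightarrow> ((nat \<Rightarrow> 'a) \<Rightarrow> real) \<Rightarrow> nat \<Rightarrow> 'w \<Rightarrow> real" where
  "Gam0_term P M X X' f g k =
     real_cond_exp P (sigma_coords P M X UNIV) (swap_prod X X' f g k)"

text \<open>\<open>\<Gamma>\<^sub>0(F, G)\<close> computed from representatives \<open>f\<close> of \<open>F\<close> and \<open>g\<close> of \<open>G\<close>.\<close>

definition Gam0 ::
    "'w measure \<Rightarrow> (nat \<Rightarrow> 'a measure) \<Rightarrow> ('w \<Rightarrow> nat \<Rightarrow> 'a) \<Rightarrow> ('w \<Rightarrow> nat \<Rightarrow> 'a) \<Rightarrow>
     ((nat \<Rightarrow> 'a) \<Rightarrow> real) \<Rightarrow> ((nat \<Rightarrow> 'a) \<Rightarrow> real) \<Rightarrow> 'w \<Rightarrow> real" where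
  "Gam0 P M X X' f g \<omega> = (\<Sum>k. Gam0_term P M X X' f g k \<omega>) / 2"

end

theory Submission
  imports Defs
begin

text \<open>
  Let \<open>f'\<close> denote \<open>f\<close> with the \<open>k\<close>-th coordinate resampled.  Since the resampling is
  exchangeable, \<open>E[D\<^sub>k F D\<^sub>k G] = E[(f' - f) (g' - g)] / 2\<close>, so that, for a bounded random
  variable \<open>H\<close> depending on finitely many coordinates, duality of \<open>D\<close> and \<open>\<delta>\<close> and the identity
  \<open>- (h' - h) (f' g' - f g) + (h' g' - h g) (f' - f) + (h' f' - h f) (g' - g) = (h + h') (f' - f) (g' - g)\<close>
  give \<open>E[H \<Gamma>(F, G)] = E[H \<Gamma>\<^sub>0(F, G)]\<close>.  Such \<open>H\<close> separate \<open>\<sigma>(X)\<close>-measurable integrable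
  functions.  That \<open>\<delta>\<close> is well defined is the Riesz representation theorem in \<open>L\<^sup>2\<close>.
\<close>

section \<open>Square-integrable functions\<close>

text \<open>The divergence obeys no product rule, so expressions such as E[H F LG] are treated by
  taking H F itself as test function in the duality. This needs H F in the domain of
  \<open>D\<close>, which is why H depends on finitely many coordinates: D_k (H F) = H D_k F for all
  later k, and the finitely many remaining terms are controlled by the L2 contraction D_k.
  Boundedness of H also makes its product with \<Gamma>(F, G), which is merely integrable,
  integrable. The hypothesis on F G is used for L(F G) and for square integrability of F G, on which
  the formula for E[D_k H D_k (F G)] rests. Integrability of \<Gamma>_0 has a source of its own:
  E|(f' - f) (g' - g)| is at most 2 E[(D_k F)^2] + 2 E[(D_k G)^2], which is summable in k. The same
  bound justifies exchanging series and integral. Identities for a single k are proved on the law of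
  (X, X'_k), where exchanging the k-th coordinate with the fresh value preserves the measure. The
  factor h + h' therefore counts one integral twice, which compensates the 1/2 in the formula for
  E[D_k F D_k G].\<close>

lemma L2_spaceI: "f \<in> borel_measurable N \<Longrightarrow> integrable N (\<lambda>x. (f x)\<^sup>2) \<Longrightarrow> f \<in> L2_space N"
  by (simp add: L2_space_def)

lemma L2_space_measurable: "f \<in> L2_space N \<Longrightarrow> f \<in> borel_measurable N"
  and L2_space_square: "f \<in> L2_space N \<Longrightarrow> integrable N (\<lambda>x. (f x)\<^sup>2)"
  by (simp_all add: L2_space_def)

lemma abs_mult_le_squares: "\<bar>a * b\<bar> \<le> a\<^sup>2 + b\<^sup>2" for a b :: real
proof -
  have "2 * (\<bar>a\<bar> * \<bar>b\<bar>) \<le> a\<^sup>2 + b\<^sup>2"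
    using zero_le_power2[of "\<bar>a\<bar> - \<bar>b\<bar>"] by (simp add: power2_diff)
  moreover have "0 \<le> \<bar>a\<bar> * \<bar>b\<bar>" by simp
  ultimately show ?thesis unfolding abs_mult by linarith
qed

lemma L2_space_mult:
  assumes f: "f \<in> L2_space N" and g: "g \<in> L2_space N"
  shows "integrable N (\<lambda>x. f x * g x)"
proof (rule Bochner_Integration.integrable_bound)
  show "integrable N (\<lambda>x. (f x)\<^sup>2 + (g x)\<^sup>2)"
    using f g by (intro Bochner_Integration.integrable_add L2_space_square)
  show "(\<lambda>x. f x * g x) \<in> borel_measurable N"
    using f g by (intro borel_measurable_times L2_space_measurable)
  show "AE x in N. norm (f x * g x) \<le> norm ((f x)\<^sup>2 + (g x)\<^sup>2)"
    using abs_mult_le_squares by (intro AE_I2) simp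
qed

lemma integral_mult_le_squares:
  assumes f: "f \<in> L2_space N" and g: "g \<in> L2_space N"
  shows "(\<integral>\<omega>. \<bar>f \<omega> * g \<omega>\<bar> \<partial>N) \<le> (\<integral>\<omega>. (f \<omega>)\<^sup>2 \<partial>N) + (\<integral>\<omega>. (g \<omega>)\<^sup>2 \<partial>N)"
proof -
  have "(\<integral>\<omega>. \<bar>f \<omega> * g \<omega>\<bar> \<partial>N) \<le> (\<integral>\<omega>. (f \<omega>)\<^sup>2 + (g \<omega>)\<^sup>2 \<partial>N)"
    using f g by (intro integral_mono abs_mult_le_squares integrable_abs L2_space_mult Bochner_Integration.integrable_add L2_space_square)
  also have "\<dots> = (\<integral>\<omega>. (f \<omega>)\<^sup>2 \<partial>N) + (\<integral>\<omega>. (g \<omega>)\<^sup>2 \<partial>N)"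
    using f g by (intro Bochner_Integration.integral_add L2_space_square)
  finally show ?thesis .
qed

lemma L2_space_lin:
  fixes c d :: real
  assumes f: "f \<in> L2_space N" and g: "g \<in> L2_space N"
  shows "(\<lambda>x. c * f x + d * g x) \<in> L2_space N"
proof (rule L2_spaceI)
  show "(\<lambda>x. c * f x + d * g x) \<in> borel_measurable N"
    using f g by (intro borel_measurable_times borel_measurable_add borel_measurable_const L2_space_measurable)
  have "integrable N (\<lambda>x. c\<^sup>2 * (f x)\<^sup>2 + d\<^sup>2 * (g x)\<^sup>2 + (2 * c * d) * (f x * g x))"
    using f g by (intro Bochner_Integration.integrable_add integrable_mult_right L2_space_square L2_space_mult)
  then show "integrable N (\<lambda>x. (c * f x + d * g x)\<^sup>2)"
    by (rule Bochner_Integration.integrable_cong[THEN iffD1, rotated -1]) (auto simp: power2_eq_square algebra_simps)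
qed

lemma L2_space_diff: "f \<in> L2_space N \<Longrightarrow> g \<in> L2_space N \<Longrightarrow> (\<lambda>x. f x - g x) \<in> L2_space N"
  using L2_space_lin[of f N g 1 "-1"] by simp

lemma L2_space_bounded_mult:
  fixes h :: "'a \<Rightarrow> real"
  assumes f: "f \<in> L2_space N" and h: "h \<in> borel_measurable N" "\<And>x. \<bar>h x\<bar> \<le> C"
  shows "(\<lambda>x. h x * f x) \<in> L2_space N"
proof (rule L2_spaceI)
  show "(\<lambda>x. h x * f x) \<in> borel_measurable N"
    using h(1) L2_space_measurable[OF f] by simp
  show "integrable N (\<lambda>x. (h x * f x)\<^sup>2)"
  proof (rule Bochner_Integration.integrable_bound)
    show "integrable N (\<lambda>x. C\<^sup>2 * (f x)\<^sup>2)"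
      using f by (intro integrable_mult_right L2_space_square)
    show "(\<lambda>x. (h x * f x)\<^sup>2) \<in> borel_measurable N"
      using h(1) L2_space_measurable[OF f] by simp
    have "(h x)\<^sup>2 \<le> C\<^sup>2" for x
      using h(2)[of x] by (simp add: abs_le_square_iff[symmetric])
    then show "AE x in N. norm ((h x * f x)\<^sup>2) \<le> norm (C\<^sup>2 * (f x)\<^sup>2)"
      by (auto simp: power_mult_distrib intro!: mult_right_mono)
  qed
qed

lemma (in finite_measure) L2_space_bounded:
  fixes h :: "'a \<Rightarrow> real"
  assumes "h \<in> borel_measurable M" "\<And>x. \<bar>h x\<bar> \<le> C"
  shows "h \<in> L2_space M"
  using L2_space_bounded_mult[of "\<lambda>_. 1" M h C] assms by (simp add: L2_space_def)

lemma (in finite_measure) L2_space_integrable: "f \<in> L2_space M \<Longrightarrow> integrable M f"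
  using L2_space_mult[of f M "\<lambda>_. 1"] by (simp add: L2_space_def)

lemma L2_space_cong_AE:
  assumes "f \<in> L2_space N" "g \<in> borel_measurable N" "AE x in N. f x = g x"
  shows "g \<in> L2_space N"
proof (rule L2_spaceI)
  note [measurable] = assms(2) L2_space_measurable[OF assms(1)]
  show "integrable N (\<lambda>x. (g x)\<^sup>2)"
    by (rule integrable_cong_AE_imp[OF L2_space_square[OF assms(1)]]) (use assms(3) in auto)
qed fact

section \<open>Conditional expectation as an orthogonal projection in L2\<close>

context finite_measure_subalgebra
begin

lemma real_cond_exp_L2:
  assumes f: "f \<in> L2_space M"
  shows "real_cond_exp M F f \<in> L2_space M"
proof (rule L2_spaceI)
  have int: "integrable M f" "integrable M (\<lambda>x. (f x)\<^sup>2)"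
    using f by (auto intro: L2_space_integrable L2_space_square)
  have "AE x in M. (real_cond_exp M F f x)\<^sup>2 \<le> real_cond_exp M F (\<lambda>x. (f x)\<^sup>2) x"
    using int by (intro real_cond_exp_jensens_inequality(2)[where q = "\<lambda>x. x\<^sup>2" and I = UNIV]) (auto intro: convex_power2)
  then show "integrable M (\<lambda>x. (real_cond_exp M F f x)\<^sup>2)"
    by (intro Bochner_Integration.integrable_bound[OF real_cond_exp_int(1)[OF int(2)]]) auto
qed simp

text \<open>Of the four terms of the expanded product two cancel, because E[f|F] is
  \<open>F\<close>-measurable and so E[E[f|F] E[g|F]] = E[E[f|F] g]. A single conditional
  expectation survives, which \<open>integral_mult_cond_exp\<close> later turns into a resampling
  integral.\<close>

lemma integral_cond_exp_diff_mult:
  assumes f: "f \<in> L2_space M" and g: "g \<in> L2_space M"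
  shows "(\<integral>x. (f x - real_cond_exp M F f x) * (g x - real_cond_exp M F g x) \<partial>M)
    = (\<integral>x. f x * g x \<partial>M) - (\<integral>x. f x * real_cond_exp M F g x \<partial>M)"
proof -
  let ?Ef = "real_cond_exp M F f" and ?Eg = "real_cond_exp M F g"
  note L2 = f g real_cond_exp_L2[OF f] real_cond_exp_L2[OF g]
  have int: "integrable M (\<lambda>x. f x * g x)" "integrable M (\<lambda>x. f x * ?Eg x)"
    "integrable M (\<lambda>x. ?Ef x * g x)" "integrable M (\<lambda>x. ?Ef x * ?Eg x)"
    using L2 by (auto intro: L2_space_mult)
  have "(\<integral>x. ?Ef x * ?Eg x \<partial>M) = (\<integral>x. ?Ef x * g x \<partial>M)"
    by (rule real_cond_exp_intg(2)) (use int L2 in \<open>auto dest: L2_space_measurable\<close>)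
  moreover have "(\<integral>x. (f x - ?Ef x) * (g x - ?Eg x) \<partial>M) =
    (\<integral>x. f x * g x \<partial>M) - (\<integral>x. f x * ?Eg x \<partial>M) - (\<integral>x. ?Ef x * g x \<partial>M) + (\<integral>x. ?Ef x * ?Eg x \<partial>M)"
    using int by (simp add: algebra_simps)
  ultimately show ?thesis by simp
qed

text \<open>The subtracted term E[f E[f|F]] equals E[E[f|F]^2] and is therefore nonnegative.\<close>

lemma integral_cond_exp_diff_square_le:
  assumes f: "f \<in> L2_space M"
  shows "(\<integral>x. (f x - real_cond_exp M F f x)\<^sup>2 \<partial>M) \<le> (\<integral>x. (f x)\<^sup>2 \<partial>M)"
proof -
  let ?Ef = "real_cond_exp M F f"
  have "(\<integral>x. ?Ef x * ?Ef x \<partial>M) = (\<integral>x. ?Ef x * f x \<partial>M)"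
    by (rule real_cond_exp_intg(2))
      (use L2_space_mult[OF real_cond_exp_L2[OF f] f] L2_space_measurable[OF f] in auto)
  moreover have "0 \<le> (\<integral>x. ?Ef x * ?Ef x \<partial>M)" by simp
  ultimately have "0 \<le> (\<integral>x. f x * ?Ef x \<partial>M)" by (simp add: mult.commute)
  then show ?thesis
    using integral_cond_exp_diff_mult[OF f f] by (simp add: power2_eq_square)
qed

end

lemma L2_space_compose:
  assumes T: "T \<in> measurable N N'" and distr: "distr N N' T = N'" and f: "f \<in> L2_space N'"
  shows "(\<lambda>x. f (T x)) \<in> L2_space N"
proof (rule L2_spaceI)
  show "(\<lambda>x. f (T x)) \<in> borel_measurable N"
    by (rule measurable_compose[OF T L2_space_measurable[OF f]])
  have "integrable (distr N N' T) (\<lambda>x. (f x)\<^sup>2)"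
    unfolding distr by (rule L2_space_square[OF f])
  then show "integrable N (\<lambda>x. (f (T x))\<^sup>2)"
    by (rule integrable_distr[OF T])
qed

lemma integral_compose:
  fixes f :: "'b \<Rightarrow> real"
  assumes "T \<in> measurable N N'" "distr N N' T = N'" "f \<in> borel_measurable N'"
  shows "(\<integral>x. f (T x) \<partial>N) = (\<integral>x. f x \<partial>N')"
  using integral_distr[OF assms(1,3)] assms(2) by simp

text \<open>By Tonelli the sum of the absolute values has finite integral, hence is finite almost
  everywhere.\<close>

lemma AE_summable_of_summable_integral:
  fixes f :: "nat \<Rightarrow> 'a \<Rightarrow> real"
  assumes int: "\<And>n. integrable N (f n)" and sum: "summable (\<lambda>n. \<integral>x. \<bar>f n x\<bar> \<partial>N)"
  shows "AE x in N. summable (\<lambda>n. \<bar>f n x\<bar>)"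
proof -
  have [measurable]: "f n \<in> borel_measurable N" for n using int by simp
  have "(\<integral>\<^sup>+x. (\<Sum>n. ennreal \<bar>f n x\<bar>) \<partial>N) = (\<Sum>n. \<integral>\<^sup>+x. ennreal \<bar>f n x\<bar> \<partial>N)"
    by (rule nn_integral_suminf) simp
  also have "\<dots> = (\<Sum>n. ennreal (\<integral>x. \<bar>f n x\<bar> \<partial>N))"
    using int by (intro suminf_cong nn_integral_eq_integral integrable_abs) simp_all
  also have "\<dots> < \<infinity>"
    using sum by (subst suminf_ennreal2) simp_all
  finally have "AE x in N. (\<Sum>n. ennreal \<bar>f n x\<bar>) \<noteq> \<infinity>"
    by (intro nn_integral_PInf_AE) simp_all
  then show ?thesis
    by eventually_elim (intro summable_suminf_not_top, simp_all)
qed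

section \<open>Cauchy-Schwarz, completeness and Riesz representation in L2\<close>

lemma L2_integral_lin_square:
  assumes f: "f \<in> L2_space N" and g: "g \<in> L2_space N"
  shows "(\<integral>x. (c * f x + d * g x)\<^sup>2 \<partial>N)
    = c\<^sup>2 * (\<integral>x. (f x)\<^sup>2 \<partial>N) + 2 * c * d * (\<integral>x. f x * g x \<partial>N) + d\<^sup>2 * (\<integral>x. (g x)\<^sup>2 \<partial>N)"
proof -
  have "(\<integral>x. (c * f x + d * g x)\<^sup>2 \<partial>N) = (\<integral>x. c\<^sup>2 * (f x)\<^sup>2 + 2 * c * d * (f x * g x) + d\<^sup>2 * (g x)\<^sup>2 \<partial>N)"
    by (intro Bochner_Integration.integral_cong) (simp_all add: power2_eq_square algebra_simps)
  also have "\<dots> = c\<^sup>2 * (\<integral>x. (f x)\<^sup>2 \<partial>N) + 2 * c * d * (\<integral>x. f x * g x \<partial>N) + d\<^sup>2 * (\<integral>x. (g x)\<^sup>2 \<partial>N)"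
    using L2_space_square[OF f] L2_space_square[OF g] L2_space_mult[OF f g] by simp
  finally show ?thesis .
qed

text \<open>The quadratic form of the Gram matrix of \<open>f\<close> and \<open>g\<close> is
  nonnegative; two evaluations of it suffice.\<close>

lemma L2_cauchy_schwarz:
  assumes f: "f \<in> L2_space N" and g: "g \<in> L2_space N"
  shows "(\<integral>x. f x * g x \<partial>N)\<^sup>2 \<le> (\<integral>x. (f x)\<^sup>2 \<partial>N) * (\<integral>x. (g x)\<^sup>2 \<partial>N)"
proof -
  define a b c where "a = (\<integral>x. (f x)\<^sup>2 \<partial>N)" "b = (\<integral>x. (g x)\<^sup>2 \<partial>N)" "c = (\<integral>x. f x * g x \<partial>N)"
  have quad: "0 \<le> s\<^sup>2 * a + 2 * s * t * c + t\<^sup>2 * b" for s t :: real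
  proof -
    have "0 \<le> (\<integral>x. (s * f x + t * g x)\<^sup>2 \<partial>N)" by simp
    then show ?thesis unfolding L2_integral_lin_square[OF f g] a_b_c_def .
  qed
  have a: "0 \<le> a" and b: "0 \<le> b" by (simp_all add: a_b_c_def)
  have "c\<^sup>2 \<le> a * b"
  proof (cases "b = 0")
    case True
    have "0 \<le> - c\<^sup>2"
      \<comment> \<open>For b = 0 this choice of s and t cancels the term with a and leaves -2 c^2,
        which forces c = 0.\<close>
      using quad[of "- c" "a / 2 + 1"] True zero_le_power2[of c] by (simp add: power2_eq_square algebra_simps)
    with True show ?thesis by simp
  next
    case False
    with b have "0 < b" by simp
    moreover have "0 \<le> b * (a * b - c\<^sup>2)"
      \<comment> \<open>Here the form evaluates to b (a b - c^2).\<close>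
      using quad[of b "- c"] by (simp add: power2_eq_square algebra_simps)
    ultimately show ?thesis by (simp add: zero_le_mult_iff)
  qed
  then show ?thesis by (simp add: a_b_c_def)
qed

text \<open>The geometric rate makes the increments summable in L1, so the sequence itself converges
  almost everywhere and no subsequence has to be chosen. Fatou's lemma then carries the bound over
  to the limit. The constant 4 is the one that the minimizing sequence in the Riesz theorem
  delivers.\<close>

lemma (in prob_space) L2_complete:
  fixes h :: "nat \<Rightarrow> 'a \<Rightarrow> real"
  assumes h: "\<And>n. h n \<in> L2_space M"
    and cauchy: "\<And>m n. m \<le> n \<Longrightarrow> (\<integral>x. (h n x - h m x)\<^sup>2 \<partial>M) \<le> 4 * (1/4) ^ m"
  shows "\<exists>V \<in> L2_space M. \<forall>m. (\<integral>x. (V x - h m x)\<^sup>2 \<partial>M) \<le> 4 * (1/4) ^ m"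
proof -
  note meas [measurable] = L2_space_measurable[OF h]
  define d where "d n x = \<bar>h (Suc n) x - h n x\<bar>" for n x
  have d_nonneg: "0 \<le> d n x" for n x by (simp add: d_def)
  have dL2: "d n \<in> L2_space M" for n
    using L2_space_diff[OF h h, of "Suc n" n] by (simp add: L2_space_def d_def[abs_def])
  have one: "(\<lambda>_. 1) \<in> L2_space M" by (simp add: L2_space_def)
  \<comment> \<open>On a probability space Cauchy-Schwarz against the constant 1 bounds the L1 norm
    by the L2 norm, whose square is at most 4 * (1/4) ^ n.\<close>
  have "(\<integral>x. d n x \<partial>M) \<le> 2 * (1/2) ^ n" for n
  proof (rule power2_le_imp_le)
    have "(\<integral>x. d n x \<partial>M)\<^sup>2 \<le> (\<integral>x. (d n x)\<^sup>2 \<partial>M)"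
      using L2_cauchy_schwarz[OF dL2 one, of n] by (simp add: prob_space)
    also have "\<dots> \<le> 4 * (1/4) ^ n" using cauchy[of n "Suc n"] by (simp add: d_def)
    also have "\<dots> = (2 * (1/2) ^ n)\<^sup>2"
      using power_mult_distrib[of "1/2 :: real" "1/2" n] by (simp add: power2_eq_square)
    finally show "(\<integral>x. d n x \<partial>M)\<^sup>2 \<le> (2 * (1/2) ^ n)\<^sup>2" .
  qed simp
  then have le: "norm (\<integral>x. \<bar>d n x\<bar> \<partial>M) \<le> 2 * (1/2) ^ n" for n
    by (simp add: d_nonneg)
  have "summable (\<lambda>n. 2 * (1/2) ^ n :: real)"
    by (intro summable_mult summable_geometric) simp
  from this le have "summable (\<lambda>n. \<integral>x. \<bar>d n x\<bar> \<partial>M)"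
    by (rule summable_comparison_test')
  then have "AE x in M. summable (\<lambda>n. \<bar>d n x\<bar>)"
    by (intro AE_summable_of_summable_integral L2_space_integrable dL2)
  then have conv: "AE x in M. convergent (\<lambda>n. h n x)"
  proof eventually_elim
    case (elim x)
    then have "summable (\<lambda>n. h (Suc n) x - h n x)"
      unfolding d_def abs_idempotent by (rule summable_rabs_cancel)
    then have "convergent (\<lambda>n. \<Sum>i<n. h (Suc i) x - h i x)" by (simp add: summable_iff_convergent)
    from convergent_add[OF this[unfolded sum_lessThan_telescope[of "\<lambda>i. h i x"]] convergent_const[of "h 0 x"]]
    show ?case by simp
  qed
  \<comment> \<open>The value of \<open>lim\<close> at points of divergence is arbitrary, but these
    points form a null set.\<close>
  define V where "V x = lim (\<lambda>n. h n x)" for x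
  have [measurable]: "V \<in> borel_measurable M" unfolding V_def by measurable
  have bound: "(\<integral>\<^sup>+x. ennreal ((V x - h m x)\<^sup>2) \<partial>M) \<le> ennreal (4 * (1/4) ^ m)" for m
  proof -
    have "(\<integral>\<^sup>+x. ennreal ((V x - h m x)\<^sup>2) \<partial>M) = (\<integral>\<^sup>+x. liminf (\<lambda>n. ennreal ((h n x - h m x)\<^sup>2)) \<partial>M)"
    proof (rule nn_integral_cong_AE)
      show "AE x in M. ennreal ((V x - h m x)\<^sup>2) = liminf (\<lambda>n. ennreal ((h n x - h m x)\<^sup>2))"
        using conv
      proof eventually_elim
        case (elim x)
        then have "(\<lambda>n. h n x) \<longlonglongrightarrow> V x" unfolding V_def by (simp add: convergent_LIMSEQ_iff)
        then have "(\<lambda>n. ennreal ((h n x - h m x)\<^sup>2)) \<longlonglongrightarrow> ennreal ((V x - h m x)\<^sup>2)"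
          by (intro tendsto_intros)
        then show ?case by (intro lim_imp_Liminf[symmetric]) simp_all
      qed
    qed
    also have "\<dots> \<le> liminf (\<lambda>n. \<integral>\<^sup>+x. ennreal ((h n x - h m x)\<^sup>2) \<partial>M)"
      by (rule nn_integral_liminf) simp
    also have "\<dots> \<le> limsup (\<lambda>n. \<integral>\<^sup>+x. ennreal ((h n x - h m x)\<^sup>2) \<partial>M)"
      by (rule Liminf_le_Limsup) simp
    also have "\<dots> \<le> ennreal (4 * (1/4) ^ m)"
    proof (rule Limsup_bounded)
      show "\<forall>\<^sub>F n in sequentially. (\<integral>\<^sup>+x. ennreal ((h n x - h m x)\<^sup>2) \<partial>M) \<le> ennreal (4 * (1/4) ^ m)"
        using eventually_ge_at_top[of m]
      proof eventually_elim
        case (elim n)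
        have "(\<integral>\<^sup>+x. ennreal ((h n x - h m x)\<^sup>2) \<partial>M) = ennreal (\<integral>x. (h n x - h m x)\<^sup>2 \<partial>M)"
          by (intro nn_integral_eq_integral L2_space_square L2_space_diff h) simp
        with cauchy[OF elim] show ?case by (simp add: ennreal_leI)
      qed
    qed
    finally show ?thesis .
  qed
  have diff: "(\<lambda>x. V x - h m x) \<in> L2_space M" for m
  proof (rule L2_spaceI)
    show "integrable M (\<lambda>x. (V x - h m x)\<^sup>2)"
      using le_less_trans[OF bound[of m] ennreal_less_top] by (intro integrableI_bounded) simp_all
  qed simp
  have "V \<in> L2_space M" using L2_space_lin[OF diff[of 0] h[of 0], of 1 1] by simp
  moreover have "(\<integral>x. (V x - h m x)\<^sup>2 \<partial>M) \<le> 4 * (1/4) ^ m" for m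
    using bound[of m] L2_space_square[OF diff[of m]] by (subst (asm) nn_integral_eq_integral) simp_all
  ultimately show ?thesis by blast
qed

text \<open>The representing function is the minimizer of \<open>\<parallel>f\<parallel>\<^sup>2 - 2 l f\<close>; a minimizing
  sequence is Cauchy by the parallelogram identity.\<close>

theorem (in prob_space) L2_riesz_representation:
  fixes S :: "('a \<Rightarrow> real) set" and l :: "('a \<Rightarrow> real) \<Rightarrow> real"
  assumes S: "S \<subseteq> L2_space M" "S \<noteq> {}"
    and S_lin: "\<And>f g c d. f \<in> S \<Longrightarrow> g \<in> S \<Longrightarrow> (\<lambda>x. c * f x + d * g x) \<in> S"
    and l_lin: "\<And>f g c d. f \<in> S \<Longrightarrow> g \<in> S \<Longrightarrow> l (\<lambda>x. c * f x + d * g x) = c * l f + d * l g"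
    and l_bound: "\<And>f. f \<in> S \<Longrightarrow> \<bar>l f\<bar> \<le> C * L2_nrm M f"
  shows "\<exists>V \<in> L2_space M. \<forall>f \<in> S. (\<integral>x. f x * V x \<partial>M) = l f"
proof -
  define n2 where "n2 f = (\<integral>x. (f x)\<^sup>2 \<partial>M)" for f :: "'a \<Rightarrow> real"
  define J where "J f = n2 f - 2 * l f" for f
  have L2: "f \<in> L2_space M" if "f \<in> S" for f using S that by auto
  \<comment> \<open>Bounding l f by C times the norm of f leaves norm^2 - 2 C norm, and completing
    the square gives the lower bound.\<close>
  have "- C\<^sup>2 \<le> J f" if "f \<in> S" for f
  proof -
    have "(L2_nrm M f)\<^sup>2 = n2 f" by (simp add: L2_nrm_def n2_def)
    moreover have "0 \<le> (L2_nrm M f - C)\<^sup>2" by simp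
    ultimately show ?thesis using l_bound[OF that] by (simp add: J_def power2_diff algebra_simps)
  qed
  then have bdd: "bdd_below (J ` S)" by (intro bdd_belowI[of _ "- C\<^sup>2"]) auto
  define c where "c = Inf (J ` S)"
  have c_le: "c \<le> J f" if "f \<in> S" for f unfolding c_def using bdd that by (intro cInf_lower) auto
  have "\<exists>f \<in> S. J f < c + (1/4) ^ n" for n
    using cInf_lessD[of "J ` S" "c + (1/4) ^ n"] S(2) by (auto simp: c_def)
  \<comment> \<open>The infimum may not be attained on \<open>S\<close>, so near-minimizers are
    chosen, with tolerances matched to the rate in \<open>L2_complete\<close>.\<close>
  then obtain h where h: "\<And>n. h n \<in> S" "\<And>n. J (h n) < c + (1/4) ^ n" by metis
  have "(\<integral>x. (h n x - h m x)\<^sup>2 \<partial>M) \<le> 4 * (1/4) ^ m" if "m \<le> n" for m n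
  proof -
    have mid: "(\<lambda>x. 1/2 * h n x + 1/2 * h m x) \<in> S" by (intro S_lin h)
    note L2_integral_lin_square[OF L2[OF h(1)[of n]] L2[OF h(1)[of m]]]
    from this[of "1/2" "1/2"] this[of 1 "-1"]
    \<comment> \<open>In the parallelogram identity the contributions of the linear functional
      cancel, so n2 may be replaced by J. The midpoint lies in \<open>S\<close>, where J is at least
      c.\<close>
    have "(\<integral>x. (h n x - h m x)\<^sup>2 \<partial>M) = 2 * J (h n) + 2 * J (h m) - 4 * J (\<lambda>x. 1/2 * h n x + 1/2 * h m x)"
      unfolding J_def l_lin[OF h(1) h(1)] by (simp add: n2_def power2_eq_square)
    then have "(\<integral>x. (h n x - h m x)\<^sup>2 \<partial>M) \<le> 2 * (1/4) ^ n + 2 * (1/4) ^ m"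
      using c_le[OF mid] h(2)[of n] h(2)[of m] by linarith
    moreover have "(1/4 :: real) ^ n \<le> (1/4) ^ m" using that by (intro power_decreasing) auto
    ultimately show ?thesis by linarith
  qed
  from L2_complete[OF L2[OF h(1)] this] obtain V where V: "V \<in> L2_space M"
    and conv: "\<And>m. (\<integral>x. (V x - h m x)\<^sup>2 \<partial>M) \<le> 4 * (1/4) ^ m" by blast
  have "(\<integral>x. f x * V x \<partial>M) = l f" if f: "f \<in> S" for f
  proof -
    define \<Delta> where "\<Delta> = (\<integral>x. f x * V x \<partial>M) - l f"
    have lim: "(\<lambda>n. \<integral>x. h n x * f x \<partial>M) \<longlonglongrightarrow> (\<integral>x. f x * V x \<partial>M)"
    proof (rule Lim_null_comparison[THEN LIM_zero_cancel])
      show "\<forall>\<^sub>F n in sequentially. norm ((\<integral>x. h n x * f x \<partial>M) - (\<integral>x. f x * V x \<partial>M))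
          \<le> sqrt (4 * (1/4) ^ n * n2 f)"
      proof (rule always_eventually, rule allI)
        fix n
        have "(\<integral>x. (V x - h n x) * f x \<partial>M) = (\<integral>x. f x * V x \<partial>M) - (\<integral>x. h n x * f x \<partial>M)"
          using L2_space_mult[OF V L2[OF f]] L2_space_mult[OF L2[OF h(1)] L2[OF f], of n]
          by (simp add: algebra_simps)
        moreover have "(\<integral>x. (V x - h n x) * f x \<partial>M)\<^sup>2 \<le> 4 * (1/4) ^ n * n2 f"
          by (rule order_trans[OF L2_cauchy_schwarz[OF L2_space_diff[OF V L2[OF h(1)]] L2[OF f]]])
             (use conv[of n] in \<open>auto simp: n2_def intro!: mult_right_mono\<close>)
        ultimately have "((\<integral>x. h n x * f x \<partial>M) - (\<integral>x. f x * V x \<partial>M))\<^sup>2 \<le> 4 * (1/4) ^ n * n2 f"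
          by (simp add: power2_commute)
        from real_sqrt_le_mono[OF this]
        show "norm ((\<integral>x. h n x * f x \<partial>M) - (\<integral>x. f x * V x \<partial>M)) \<le> sqrt (4 * (1/4) ^ n * n2 f)"
          by simp
      qed
      have "(\<lambda>n. sqrt (4 * (1/4) ^ n * n2 f)) \<longlonglongrightarrow> sqrt (4 * 0 * n2 f)"
        by (intro tendsto_intros LIMSEQ_power_zero) simp
      then show "(\<lambda>n. sqrt (4 * (1/4) ^ n * n2 f)) \<longlonglongrightarrow> 0" by simp
    qed
    \<comment> \<open>First variation: J (h n + t f) is at least c, and J (h n) exceeds c by less
      than (1/4) ^ n. Expanding the difference of the two and letting n tend to infinity gives the
      claim.\<close>
    have quad: "0 \<le> 2 * t * \<Delta> + t\<^sup>2 * n2 f" for t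
    proof -
      have "0 \<le> (1/4) ^ n + 2 * t * ((\<integral>x. h n x * f x \<partial>M) - l f) + t\<^sup>2 * n2 f" for n
      proof -
        have "c \<le> J (\<lambda>x. 1 * h n x + t * f x)" by (intro c_le S_lin h f)
        then show ?thesis
          using h(2)[of n] L2_integral_lin_square[OF L2[OF h(1)[of n]] L2[OF f], of 1 t]
          unfolding J_def l_lin[OF h(1) f] by (simp add: n2_def algebra_simps)
      qed
      moreover have "(\<lambda>n. (1/4) ^ n + 2 * t * ((\<integral>x. h n x * f x \<partial>M) - l f) + t\<^sup>2 * n2 f)
          \<longlonglongrightarrow> 0 + 2 * t * \<Delta> + t\<^sup>2 * n2 f"
        unfolding \<Delta>_def by (intro tendsto_intros lim LIMSEQ_power_zero) simp
      ultimately show ?thesis by (intro LIMSEQ_le_const) auto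
    qed
    have n2f: "0 \<le> n2 f" by (simp add: n2_def)
    \<comment> \<open>The inequality is taken at t = - \<Delta> / (n2 f + 1); the added 1 keeps the
      denominator positive when n2 f = 0. Clearing denominators leaves - \<Delta>^2 (n2 f + 2), so
      \<Delta> must vanish.\<close>
    have "0 \<le> (2 * (- \<Delta> / (n2 f + 1)) * \<Delta> + (- \<Delta> / (n2 f + 1))\<^sup>2 * n2 f) * (n2 f + 1)\<^sup>2"
      by (intro mult_nonneg_nonneg quad) simp
    also have "\<dots> = - \<Delta>\<^sup>2 * (n2 f + 2)"
      using n2f by (simp add: field_simps power2_eq_square add_nonneg_eq_0_iff)
    finally have "\<Delta> = 0" using n2f by (auto simp: mult_le_0_iff zero_le_mult_iff)
    then show ?thesis by (simp add: \<Delta>_def)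
  qed
  with V show ?thesis by blast
qed

text \<open>The squared L2 norm with values in [0, \<infinity>]. Unlike the Bochner integral it does
  not default to 0 for functions outside L2, and series of such norms always make sense.\<close>

definition nn_square :: "'b measure \<Rightarrow> ('b \<Rightarrow> real) \<Rightarrow> ennreal" where
  "nn_square N f = (\<integral>\<^sup>+x. ennreal ((f x)\<^sup>2) \<partial>N)"

lemma nn_square_eq: "f \<in> L2_space N \<Longrightarrow> nn_square N f = ennreal (\<integral>x. (f x)\<^sup>2 \<partial>N)"
  unfolding nn_square_def by (intro nn_integral_eq_integral L2_space_square) simp_all

lemma L2_space_iff_nn_square: "f \<in> L2_space N \<longleftrightarrow> f \<in> borel_measurable N \<and> nn_square N f < \<infinity>"
  unfolding L2_space_def nn_square_def by (auto simp: integrable_iff_bounded)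

lemma L2_nrm_eq: "f \<in> borel_measurable N \<Longrightarrow> L2_nrm N f = sqrt (enn2real (nn_square N f))"
  unfolding L2_nrm_def nn_square_def by (subst integral_eq_nn_integral) simp_all

lemma nn_square_cong: "AE x in N. f x = g x \<Longrightarrow> nn_square N f = nn_square N g"
  unfolding nn_square_def by (rule nn_integral_cong_AE) auto

lemma nn_square_eq_0_iff: "f \<in> borel_measurable N \<Longrightarrow> nn_square N f = 0 \<longleftrightarrow> (AE x in N. f x = 0)"
  unfolding nn_square_def by (subst nn_integral_0_iff_AE) simp_all

text \<open>The pointwise bound (a + b)^2 \<le> 2 a^2 + 2 b^2 replaces the triangle inequality; the
  factors 2 are harmless for finiteness and for convergence to 0.\<close>

lemma nn_square_lin:
  assumes [measurable]: "f \<in> borel_measurable N" "g \<in> borel_measurable N"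
  shows "nn_square N (\<lambda>x. c * f x + d * g x)
    \<le> ennreal (2 * c\<^sup>2) * nn_square N f + ennreal (2 * d\<^sup>2) * nn_square N g"
proof -
  have "(c * f x + d * g x)\<^sup>2 \<le> 2 * c\<^sup>2 * (f x)\<^sup>2 + 2 * d\<^sup>2 * (g x)\<^sup>2" for x
    using zero_le_power2[of "c * f x - d * g x"] by (simp add: power2_eq_square algebra_simps)
  then have "nn_square N (\<lambda>x. c * f x + d * g x)
      \<le> (\<integral>\<^sup>+x. ennreal (2 * c\<^sup>2) * ennreal ((f x)\<^sup>2) + ennreal (2 * d\<^sup>2) * ennreal ((g x)\<^sup>2) \<partial>N)"
    unfolding nn_square_def
    by (intro nn_integral_mono) (simp add: ennreal_leI flip: ennreal_mult ennreal_plus)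
  also have "\<dots> = ennreal (2 * c\<^sup>2) * nn_square N f + ennreal (2 * d\<^sup>2) * nn_square N g"
    unfolding nn_square_def by (simp add: nn_integral_add nn_integral_cmult)
  finally show ?thesis .
qed

lemma nn_square_bounded_mult:
  assumes [measurable]: "f \<in> borel_measurable N" and "\<And>x. \<bar>h x\<bar> \<le> C"
  shows "nn_square N (\<lambda>x. h x * f x) \<le> ennreal (C\<^sup>2) * nn_square N f"
proof -
  have "(h x)\<^sup>2 \<le> C\<^sup>2" for x
    using assms(2)[of x] by (simp add: abs_le_square_iff[symmetric])
  then have "nn_square N (\<lambda>x. h x * f x) \<le> (\<integral>\<^sup>+x. ennreal (C\<^sup>2) * ennreal ((f x)\<^sup>2) \<partial>N)"
    unfolding nn_square_def
    by (intro nn_integral_mono) (simp add: power_mult_distrib mult_right_mono ennreal_leI flip: ennreal_mult)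
  also have "\<dots> = ennreal (C\<^sup>2) * nn_square N f"
    unfolding nn_square_def by (simp add: nn_integral_cmult)
  finally show ?thesis .
qed

text \<open>Finiteness matters, since \<open>enn2real\<close> sends \<infinity> to 0.\<close>

lemma tendsto_sqrt_enn2real_0_iff:
  assumes "\<And>n. x n < \<infinity>"
  shows "(\<lambda>n. sqrt (enn2real (x n))) \<longlonglongrightarrow> 0 \<longleftrightarrow> x \<longlonglongrightarrow> 0"
proof
  assume "(\<lambda>n. sqrt (enn2real (x n))) \<longlonglongrightarrow> 0"
  from tendsto_power[OF this, of 2] have "(\<lambda>n. enn2real (x n)) \<longlonglongrightarrow> 0" by simp
  from tendsto_ennrealI[OF this] have "(\<lambda>n. ennreal (enn2real (x n))) \<longlonglongrightarrow> 0" by simp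
  moreover have "ennreal (enn2real (x n)) = x n" for n
    using assms[of n] by simp
  ultimately show "x \<longlonglongrightarrow> 0" by simp
next
  assume "x \<longlonglongrightarrow> 0"
  then have "(\<lambda>n. enn2real (x n)) \<longlonglongrightarrow> 0"
    using tendsto_enn2real[of x 0 sequentially] by simp
  from tendsto_real_sqrt[OF this] show "(\<lambda>n. sqrt (enn2real (x n))) \<longlonglongrightarrow> 0" by simp
qed

lemma tendsto_0_lin_ennreal:
  fixes x y z :: "nat \<Rightarrow> ennreal"
  assumes "x \<longlonglongrightarrow> 0" "y \<longlonglongrightarrow> 0" "\<And>n. z n \<le> ennreal a * x n + ennreal b * y n"
  shows "z \<longlonglongrightarrow> 0"
proof (rule tendsto_sandwich[of "\<lambda>_. 0" z _ "\<lambda>n. ennreal a * x n + ennreal b * y n"])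
  have "(\<lambda>n. ennreal a * x n + ennreal b * y n) \<longlonglongrightarrow> ennreal a * 0 + ennreal b * 0"
    using assms(1,2) by (intro tendsto_add ennreal_tendsto_cmult) simp_all
  then show "(\<lambda>n. ennreal a * x n + ennreal b * y n) \<longlonglongrightarrow> 0" by simp
qed (use assms(3) in simp_all)

section \<open>Resampling a coordinate\<close>

locale indep_copies = product_prob_space M UNIV + Om: prob_space P
  for M :: "nat \<Rightarrow> 'a measure" and P :: "'w measure" +
  fixes X X' :: "'w \<Rightarrow> nat \<Rightarrow> 'a"
  assumes indep: "Om.indep_var (\<Pi>\<^sub>M n\<in>UNIV. M n) X (\<Pi>\<^sub>M n\<in>UNIV. M n) X'"
    and distr_X: "distr P (\<Pi>\<^sub>M n\<in>UNIV. M n) X = (\<Pi>\<^sub>M n\<in>UNIV. M n)"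
    and distr_X': "distr P (\<Pi>\<^sub>M n\<in>UNIV. M n) X' = (\<Pi>\<^sub>M n\<in>UNIV. M n)"
begin

abbreviation \<mu> :: "(nat \<Rightarrow> 'a) measure" where "\<mu> \<equiv> \<Pi>\<^sub>M n\<in>UNIV. M n"

text \<open>The joint law of \<open>X\<close> and the single fresh value
  \<open>X' \<omega> k\<close>, as \<open>distr_X_X'\<close> shows. On a pair (x, y),
  \<open>upd k\<close> produces the resampled sequence.\<close>

abbreviation Q :: "nat \<Rightarrow> ((nat \<Rightarrow> 'a) \<times> 'a) measure" where "Q k \<equiv> \<mu> \<Otimes>\<^sub>M M k"

abbreviation upd :: "nat \<Rightarrow> (nat \<Rightarrow> 'a) \<times> 'a \<Rightarrow> nat \<Rightarrow> 'a" where
  "upd k p \<equiv> (fst p)(k := snd p)"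

abbreviation \<G> :: "nat set \<Rightarrow> 'w measure" where "\<G> \<equiv> sigma_coords P M X"

section \<open>The law of a sample together with one fresh coordinate\<close>

lemma measurable_X [measurable]: "X \<in> measurable P \<mu>"
  and measurable_X' [measurable]: "X' \<in> measurable P \<mu>"
  using indep by (auto simp: Om.indep_var_distribution_eq)

lemma measurable_upd [measurable]: "upd k \<in> measurable (Q k) \<mu>"
proof (rule measurable_PiM_single')
  show "(\<lambda>p. upd k p i) \<in> measurable (Q k) (M i)" for i
    by (cases "i = k") auto
qed (auto simp: space_pair_measure space_PiM)

lemma measurable_upd_section [measurable]:
  "x \<in> space \<mu> \<Longrightarrow> (\<lambda>y. x(k := y)) \<in> measurable (M k) \<mu>"
  using measurable_compose[OF measurable_Pair1' measurable_upd] by simp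

text \<open>The library fact on adjoining a coordinate to a product is used at an index that is
  already present: inserting k into \<open>UNIV\<close> changes nothing and the old value is
  overwritten. The pair has to be swapped to match the order used there.\<close>

lemma distr_upd: "distr (Q k) \<mu> (upd k) = \<mu>"
proof -
  interpret pair_sigma_finite \<mu> "M k" ..
  have "distr (Q k) \<mu> (upd k) = distr (distr (M k \<Otimes>\<^sub>M \<mu>) (Q k) (\<lambda>(x, y). (y, x))) \<mu> (upd k)"
    by (subst distr_pair_swap) simp
  also have "\<dots> = distr (M k \<Otimes>\<^sub>M \<mu>) \<mu> (\<lambda>(x, f). f(k := x))"
    by (subst distr_distr) (auto simp: comp_def split_beta')
  also have "\<dots> = \<mu>"
    using distr_pair_PiM_eq_PiM[of UNIV M k] prob_space by (simp add: M.prob_space_axioms)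
  finally show ?thesis .
qed

text \<open>Exchangeability: the map trades the k-th coordinate for the fresh value and is its own
  inverse. Rectangles determine the measure.\<close>

lemma distr_upd_component:
  "distr (Q k) (Q k) (\<lambda>p. (upd k p, fst p k)) = Q k"
proof (rule pair_measure_eqI[symmetric])
  interpret pair_sigma_finite \<mu> "M k" ..
  show "sigma_finite_measure \<mu>" "sigma_finite_measure (M k)" ..
  fix A B assume AB [measurable]: "A \<in> sets \<mu>" "B \<in> sets (M k)"
  \<comment> \<open>The probability that x lies in A after resampling coordinate k. It does not
    depend on the k-th coordinate of x, so that coordinate can be replaced by the independent
    y.\<close>
  define \<nu> where "\<nu> x = (\<integral>\<^sup>+y. indicator A (x(k := y)) \<partial>M k)" for x
  have [measurable]: "\<nu> \<in> borel_measurable \<mu>"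
  proof -
    have "(\<lambda>p. indicator A (upd k p) :: ennreal) \<in> borel_measurable (Q k)" by measurable
    then show ?thesis unfolding \<nu>_def
      by (intro M.borel_measurable_nn_integral) (simp add: split_beta')
  qed
  have "emeasure (distr (Q k) (Q k) (\<lambda>p. (upd k p, fst p k))) (A \<times> B)
      = (\<integral>\<^sup>+p. indicator A (upd k p) * indicator B (fst p k) \<partial>Q k)"
    by (subst nn_integral_indicator[symmetric], simp, subst nn_integral_distr)
       (auto intro!: nn_integral_cong simp: indicator_times)
  also have "\<dots> = (\<integral>\<^sup>+x. \<integral>\<^sup>+y. indicator A (x(k := y)) * indicator B (x k) \<partial>M k \<partial>\<mu>)"
    by (subst M.nn_integral_fst[symmetric]) auto
  also have "\<dots> = (\<integral>\<^sup>+x. \<nu> x * indicator B (x k) \<partial>\<mu>)"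
    unfolding \<nu>_def by (intro nn_integral_cong nn_integral_multc) measurable
  \<comment> \<open>Invariance of \<mu> under resampling is read backwards; afterwards \<nu> ignores
    the update and the updated coordinate is \<open>snd p\<close>.\<close>
  also have "\<dots> = (\<integral>\<^sup>+p. \<nu> (upd k p) * indicator B (upd k p k) \<partial>Q k)"
    by (subst distr_upd[of k, symmetric], subst nn_integral_distr) auto
  also have "\<dots> = (\<integral>\<^sup>+p. \<nu> (fst p) * indicator B (snd p) \<partial>Q k)"
    by (simp add: \<nu>_def)
  also have "\<dots> = (\<integral>\<^sup>+x. \<integral>\<^sup>+y. \<nu> x * indicator B y \<partial>M k \<partial>\<mu>)"
    by (subst M.nn_integral_fst[symmetric]) auto
  also have "\<dots> = (\<integral>\<^sup>+x. \<nu> x \<partial>\<mu>) * emeasure (M k) B"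
    by (simp add: nn_integral_cmult nn_integral_multc)
  also have "(\<integral>\<^sup>+x. \<nu> x \<partial>\<mu>) = (\<integral>\<^sup>+p. indicator A (upd k p) \<partial>Q k)"
    unfolding \<nu>_def by (subst M.nn_integral_fst[symmetric]) auto
  also have "\<dots> = emeasure \<mu> A"
    by (subst (2) distr_upd[of k, symmetric], subst nn_integral_indicator[symmetric], simp,
        subst nn_integral_distr) auto
  finally show "emeasure \<mu> A * emeasure (M k) B
      = emeasure (distr (Q k) (Q k) (\<lambda>p. (upd k p, fst p k))) (A \<times> B)" by (rule sym)
qed simp

lemma measurable_pair_X_X' [measurable]: "(\<lambda>\<omega>. (X \<omega>, X' \<omega> k)) \<in> measurable P (Q k)"
  by measurable

text \<open>Independence makes the joint law of \<open>X\<close> and \<open>X'\<close> a product,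
  whose second factor is then projected to coordinate k.\<close>

lemma distr_X_X': "distr P (Q k) (\<lambda>\<omega>. (X \<omega>, X' \<omega> k)) = Q k"
proof -
  have *: "distr P (\<mu> \<Otimes>\<^sub>M \<mu>) (\<lambda>\<omega>. (X \<omega>, X' \<omega>)) = \<mu> \<Otimes>\<^sub>M \<mu>"
    using indep by (simp add: Om.indep_var_distribution_eq distr_X distr_X')
  have "distr P (Q k) (\<lambda>\<omega>. (X \<omega>, X' \<omega> k))
      = distr (distr P (\<mu> \<Otimes>\<^sub>M \<mu>) (\<lambda>\<omega>. (X \<omega>, X' \<omega>))) (Q k) (\<lambda>p. (fst p, snd p k))"
    by (subst distr_distr) (auto simp: comp_def)
  also have "\<dots> = distr (\<mu> \<Otimes>\<^sub>M \<mu>) (distr \<mu> \<mu> (\<lambda>x. x) \<Otimes>\<^sub>M distr \<mu> (M k) (\<lambda>x. x k)) (\<lambda>(x, y). (x, y k))"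
    unfolding * by (intro distr_cong sets_pair_measure_cong) (auto simp: split_beta')
  also have "\<dots> = distr \<mu> \<mu> (\<lambda>x. x) \<Otimes>\<^sub>M distr \<mu> (M k) (\<lambda>x. x k)"
    by (subst pair_measure_distr) (auto simp: PiM_component M.sigma_finite_measure_axioms)
  also have "\<dots> = Q k"
    by (simp add: PiM_component)
  finally show ?thesis .
qed

section \<open>The sigma-algebras generated by sets of coordinates\<close>

lemma space_G [simp]: "space (\<G> J) = space P"
  unfolding sigma_coords_def by (rule space_measure_of) auto

lemma sets_G: "sets (\<G> J) = sigma_sets (space P)
    {(\<lambda>\<omega>. X \<omega> j) -` A \<inter> space P | j A. j \<in> J \<and> A \<in> sets (M j)}"
  unfolding sigma_coords_def by (rule sets_measure_of) auto

lemma subalgebra_G [simp]: "subalgebra P (\<G> J)"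
proof -
  have "(\<lambda>\<omega>. X \<omega> j) -` A \<inter> space P \<in> sets P" if "A \<in> sets (M j)" for j A
    using that by measurable
  then have "sets (\<G> J) \<subseteq> sets P"
    unfolding sets_G by (intro sets.sigma_sets_subset) blast
  then show ?thesis by (simp add: subalgebra_def)
qed

lemma sets_G_mono: "J \<subseteq> K \<Longrightarrow> sets (\<G> J) \<subseteq> sets (\<G> K)"
  unfolding sets_G by (rule sigma_sets_mono') auto

lemma measurable_G_mono: "J \<subseteq> K \<Longrightarrow> f \<in> measurable (\<G> J) N \<Longrightarrow> f \<in> measurable (\<G> K) N"
  using sets_G_mono[of J K] by (auto simp: measurable_def)

lemma measurable_G_P: "f \<in> measurable (\<G> J) N \<Longrightarrow> f \<in> measurable P N"
  by (rule measurable_from_subalg[OF subalgebra_G])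

lemma measurable_component_G: "j \<in> J \<Longrightarrow> (\<lambda>\<omega>. X \<omega> j) \<in> measurable (\<G> J) (M j)"
proof (rule measurableI)
  show "X \<omega> j \<in> space (M j)" if "\<omega> \<in> space (\<G> J)" for \<omega>
    using measurable_space[OF measurable_X, of \<omega>] that by (auto simp: space_PiM)
  show "j \<in> J \<Longrightarrow> A \<in> sets (M j) \<Longrightarrow> (\<lambda>\<omega>. X \<omega> j) -` A \<inter> space (\<G> J) \<in> sets (\<G> J)" for A
    by (auto simp: sets_G)
qed

text \<open>The invariance holds for generators and survives complements and countable unions. For J
  = - {k} it says that B does not see coordinate k, as needed for conditional expectations; for J =
  \<open>UNIV\<close> it is vacuous and only the factorization through \<open>X\<close>
  remains.\<close>

lemma sets_GD:
  assumes "A \<in> sets (\<G> J)"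
  shows "\<exists>B \<in> sets \<mu>. A = X -` B \<inter> space P \<and>
    (\<forall>x \<in> space \<mu>. \<forall>k \<in> - J. \<forall>y \<in> space (M k). x(k := y) \<in> B \<longleftrightarrow> x \<in> B)"
  using assms unfolding sets_G
proof (induction rule: sigma_sets.induct)
  case (Basic a)
  then obtain j A where jA: "a = (\<lambda>\<omega>. X \<omega> j) -` A \<inter> space P" "j \<in> J" "A \<in> sets (M j)" by auto
  show ?case
  proof (intro bexI conjI)
    show "(\<lambda>x. x j) -` A \<inter> space \<mu> \<in> sets \<mu>" using jA by measurable
    show "a = X -` ((\<lambda>x. x j) -` A \<inter> space \<mu>) \<inter> space P"
      using jA measurable_space[OF measurable_X] by auto
  qed (use jA in \<open>auto simp: space_PiM\<close>)
next
  case Empty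
  show ?case by (intro bexI[of _ "{}"]) auto
next
  case (Compl a)
  then obtain B where B: "B \<in> sets \<mu>" "a = X -` B \<inter> space P"
    "\<forall>x \<in> space \<mu>. \<forall>k \<in> - J. \<forall>y \<in> space (M k). x(k := y) \<in> B \<longleftrightarrow> x \<in> B" by blast
  show ?case
  proof (intro bexI conjI ballI)
    show "space P - a = X -` (space \<mu> - B) \<inter> space P"
      using B(2) measurable_space[OF measurable_X] by blast
    show "x(k := y) \<in> space \<mu> - B \<longleftrightarrow> x \<in> space \<mu> - B"
      if "x \<in> space \<mu>" "k \<in> - J" "y \<in> space (M k)" for x k y
      using B(3) that by (simp add: space_PiM PiE_UNIV_domain Pi_iff)
  next
    show "space \<mu> - B \<in> sets \<mu>" using B(1) by simp
  qed
next
  case (Union a)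
  then have "\<forall>i. \<exists>B \<in> sets \<mu>. a i = X -` B \<inter> space P \<and>
    (\<forall>x \<in> space \<mu>. \<forall>k \<in> - J. \<forall>y \<in> space (M k). x(k := y) \<in> B \<longleftrightarrow> x \<in> B)" by blast
  then have "\<exists>B. \<forall>i. B i \<in> sets \<mu> \<and> a i = X -` B i \<inter> space P \<and>
    (\<forall>x \<in> space \<mu>. \<forall>k \<in> - J. \<forall>y \<in> space (M k). x(k := y) \<in> B i \<longleftrightarrow> x \<in> B i)"
    unfolding Bex_def by (rule choice)
  then obtain B where "\<forall>i. B i \<in> sets \<mu> \<and> a i = X -` B i \<inter> space P \<and>
    (\<forall>x \<in> space \<mu>. \<forall>k \<in> - J. \<forall>y \<in> space (M k). x(k := y) \<in> B i \<longleftrightarrow> x \<in> B i)"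
    by (rule exE)
  note B = this[rule_format, THEN conjunct1] this[rule_format, THEN conjunct2, THEN conjunct1]
    this[THEN spec, THEN conjunct2, THEN conjunct2]
  show ?case
  proof (intro bexI conjI ballI)
    show "(\<Union>i. a i) = X -` (\<Union>i. B i) \<inter> space P" using B(2) by blast
    show "x(k := y) \<in> (\<Union>i. B i) \<longleftrightarrow> x \<in> (\<Union>i. B i)"
      if "x \<in> space \<mu>" "k \<in> - J" "y \<in> space (M k)" for x k y
      using B(3) that by blast
    show "(\<Union>i. B i) \<in> sets \<mu>" using B(1) by blast
  qed
qed

text \<open>Indicators factor by \<open>sets_GD\<close>; sums, multiples and suprema inherit the
  factorization.\<close>

lemma doob_dynkin_ennreal:
  fixes F :: "'w \<Rightarrow> ennreal"
  assumes "F \<in> borel_measurable (\<G> UNIV)"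
  shows "\<exists>f \<in> borel_measurable \<mu>. \<forall>\<omega> \<in> space P. F \<omega> = f (X \<omega>)"
  using assms
proof (induction rule: borel_measurable_induct)
  case (cong f g)
  then show ?case by simp
next
  case (set A)
  then obtain B where "B \<in> sets \<mu>" "A = X -` B \<inter> space P" using sets_GD by blast
  then show ?case by (intro bexI[of _ "indicator B"] ballI) (simp_all split: split_indicator)
next
  case (mult u c)
  then obtain f where "f \<in> borel_measurable \<mu>" "\<forall>\<omega> \<in> space P. u \<omega> = f (X \<omega>)" by blast
  then show ?case by (intro bexI[of _ "\<lambda>x. c * f x"]) simp_all
next
  case (add u v)
  then obtain f g where "f \<in> borel_measurable \<mu>" "\<forall>\<omega> \<in> space P. u \<omega> = f (X \<omega>)"
     "g \<in> borel_measurable \<mu>" "\<forall>\<omega> \<in> space P. v \<omega> = g (X \<omega>)" by blast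
  then show ?case by (intro bexI[of _ "\<lambda>x. g x + f x"]) simp_all
next
  case (seq U)
  then have "\<forall>i. \<exists>f \<in> borel_measurable \<mu>. \<forall>\<omega> \<in> space P. U i \<omega> = f (X \<omega>)" by blast
  then obtain f where "\<forall>i. f i \<in> borel_measurable \<mu> \<and> (\<forall>\<omega> \<in> space P. U i \<omega> = f i (X \<omega>))"
    unfolding Bex_def by (rule choice[THEN exE])
  then show ?case
    by (intro bexI[of _ "\<lambda>x. SUP i. f i x"] borel_measurable_SUP ballI) (simp_all add: image_comp)
qed

lemma doob_dynkin:
  fixes F :: "'w \<Rightarrow> real"
  assumes [measurable]: "F \<in> borel_measurable (\<G> UNIV)"
  obtains f where "f \<in> borel_measurable \<mu>" "\<And>\<omega>. \<omega> \<in> space P \<Longrightarrow> F \<omega> = f (X \<omega>)"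
proof -
  \<comment> \<open>Since \<open>ennreal\<close> truncates negative reals to 0, these are the
    positive and the negative part of F.\<close>
  have "(\<lambda>\<omega>. ennreal (F \<omega>)) \<in> borel_measurable (\<G> UNIV)" "(\<lambda>\<omega>. ennreal (- F \<omega>)) \<in> borel_measurable (\<G> UNIV)"
    by auto
  from this[THEN doob_dynkin_ennreal] obtain f g where
    fg: "f \<in> borel_measurable \<mu>" "\<And>\<omega>. \<omega> \<in> space P \<Longrightarrow> ennreal (F \<omega>) = f (X \<omega>)"
    "g \<in> borel_measurable \<mu>" "\<And>\<omega>. \<omega> \<in> space P \<Longrightarrow> ennreal (- F \<omega>) = g (X \<omega>)" by blast
  show ?thesis
  proof
    show "(\<lambda>x. enn2real (f x) - enn2real (g x)) \<in> borel_measurable \<mu>" using fg by auto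
    show "F \<omega> = enn2real (f (X \<omega>)) - enn2real (g (X \<omega>))" if "\<omega> \<in> space P" for \<omega>
      using fg(2,4)[OF that, symmetric] by (cases "F \<omega> \<ge> 0") (auto simp: ennreal_neg)
  qed
qed

section \<open>The restriction of the measure to sigma(X), and the gradient\<close>

sublocale \<G>: finite_measure_subalgebra P "sigma_coords P M X J" for J
  by unfold_locales simp

abbreviation D :: "('w \<Rightarrow> real) \<Rightarrow> nat \<Rightarrow> 'w \<Rightarrow> real" where "D \<equiv> mall_D P M X"

lemma sets_P_F [measurable_cong]: "sets (P_F P M X) = sets (\<G> UNIV)"
  unfolding P_F_def by (rule sets_restr_to_subalg) simp

lemma prob_space_P_F: "prob_space (P_F P M X)"
  unfolding P_F_def by (rule prob_space_restr_to_subalg[OF subalgebra_G Om.prob_space_axioms])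

lemma integral_P_F:
  fixes f :: "'w \<Rightarrow> real"
  shows "f \<in> borel_measurable (\<G> UNIV) \<Longrightarrow> (\<integral>\<omega>. f \<omega> \<partial>P_F P M X) = (\<integral>\<omega>. f \<omega> \<partial>P)"
  unfolding P_F_def by (rule integral_subalgebra2) simp

lemma nn_integral_P_F: "f \<in> borel_measurable (\<G> UNIV) \<Longrightarrow> (\<integral>\<^sup>+\<omega>. f \<omega> \<partial>P_F P M X) = (\<integral>\<^sup>+\<omega>. f \<omega> \<partial>P)"
  unfolding P_F_def by (rule nn_integral_subalgebra2) simp

lemma integrable_P_F_iff:
  fixes f :: "'w \<Rightarrow> real"
  assumes "f \<in> borel_measurable (\<G> UNIV)"
  shows "integrable (P_F P M X) f \<longleftrightarrow> integrable P f"
  unfolding P_F_def using assms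
  by (auto intro: integrable_in_subalg[OF subalgebra_G] integrable_from_subalg[OF subalgebra_G])

lemma L2_X_iff: "F \<in> L2_X P M X \<longleftrightarrow> F \<in> borel_measurable (\<G> UNIV) \<and> F \<in> L2_space P"
proof -
  have "F \<in> borel_measurable (P_F P M X) \<longleftrightarrow> F \<in> borel_measurable (\<G> UNIV)"
    by (simp add: measurable_cong_sets[OF sets_P_F])
  moreover have "integrable (P_F P M X) (\<lambda>\<omega>. (F \<omega>)\<^sup>2) \<longleftrightarrow> F \<in> L2_space P"
    if "F \<in> borel_measurable (\<G> UNIV)"
    using integrable_P_F_iff[OF borel_measurable_power[OF that]] measurable_G_P[OF that]
    by (simp add: L2_space_def)
  ultimately show ?thesis
    by (metis L2_X_def L2_spaceI L2_space_measurable L2_space_square)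
qed

lemma D_measurable: "F \<in> borel_measurable (\<G> UNIV) \<Longrightarrow> D F k \<in> borel_measurable (\<G> UNIV)"
  unfolding mall_D_def
  by (intro borel_measurable_diff measurable_G_mono[OF subset_UNIV borel_measurable_cond_exp])

lemma D_L2: "F \<in> L2_space P \<Longrightarrow> D F k \<in> L2_space P"
  unfolding mall_D_def by (intro L2_space_diff \<G>.real_cond_exp_L2)

lemma D_lin:
  assumes "F \<in> L2_space P" "H \<in> L2_space P"
  shows "AE \<omega> in P. D (\<lambda>\<omega>. c * F \<omega> + d * H \<omega>) k \<omega> = c * D F k \<omega> + d * D H k \<omega>"
proof -
  have "integrable P F" "integrable P H" using assms by (auto intro: Om.L2_space_integrable)
  then have "AE \<omega> in P. real_cond_exp P (\<G> (-{k})) (\<lambda>\<omega>. c * F \<omega> + d * H \<omega>) \<omega>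
      = real_cond_exp P (\<G> (-{k})) (\<lambda>\<omega>. c * F \<omega>) \<omega> + real_cond_exp P (\<G> (-{k})) (\<lambda>\<omega>. d * H \<omega>) \<omega>"
    "AE \<omega> in P. real_cond_exp P (\<G> (-{k})) (\<lambda>\<omega>. c * F \<omega>) \<omega> = c * real_cond_exp P (\<G> (-{k})) F \<omega>"
    "AE \<omega> in P. real_cond_exp P (\<G> (-{k})) (\<lambda>\<omega>. d * H \<omega>) \<omega> = d * real_cond_exp P (\<G> (-{k})) H \<omega>"
    by auto
  then show ?thesis unfolding mall_D_def
    by eventually_elim (simp add: algebra_simps)
qed

lemma D_cong:
  assumes "F \<in> borel_measurable P" "H \<in> borel_measurable P" "AE \<omega> in P. F \<omega> = H \<omega>"
  shows "AE \<omega> in P. D F k \<omega> = D H k \<omega>"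
  using \<G>.real_cond_exp_cong[OF assms(3,1,2)] assms(3) unfolding mall_D_def
  by eventually_elim simp

lemma D_square_le: "F \<in> L2_space P \<Longrightarrow> (\<integral>\<omega>. (D F k \<omega>)\<^sup>2 \<partial>P) \<le> (\<integral>\<omega>. (F \<omega>)\<^sup>2 \<partial>P)"
  unfolding mall_D_def by (rule \<G>.integral_cond_exp_diff_square_le)

text \<open>For k > n the first n + 1 coordinates avoid k, so F equals its own conditional
  expectation.\<close>

lemma D_eq_0:
  assumes "integrable P F" "F \<in> borel_measurable (\<G> {..n})" "n < k"
  shows "AE \<omega> in P. D F k \<omega> = 0"
proof -
  have "F \<in> borel_measurable (\<G> (-{k}))"
    by (rule measurable_G_mono[OF _ assms(2)]) (use assms(3) in auto)
  from \<G>.real_cond_exp_F_meas[OF assms(1) this] show ?thesis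
    unfolding mall_D_def by eventually_elim simp
qed

text \<open>For k > n the factor H is measurable with respect to the coordinates other than k and
  can be pulled out. This is the available substitute for a product rule.\<close>

lemma D_mult:
  assumes "integrable P (\<lambda>\<omega>. H \<omega> * F \<omega>)" "F \<in> borel_measurable P" "H \<in> borel_measurable (\<G> {..n})" "n < k"
  shows "AE \<omega> in P. D (\<lambda>\<omega>. H \<omega> * F \<omega>) k \<omega> = H \<omega> * D F k \<omega>"
proof -
  have "H \<in> borel_measurable (\<G> (-{k}))"
    by (rule measurable_G_mono[OF _ assms(3)]) (use assms(4) in auto)
  from \<G>.real_cond_exp_mult[OF this assms(2,1)] show ?thesis
    unfolding mall_D_def by eventually_elim (simp add: algebra_simps)
qed

section \<open>Conditional expectations and gradients as resampling integrals\<close>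

lemma distr_fst: "distr (Q k) \<mu> fst = \<mu>"
  by (rule M.distr_pair_fst)

lemma L2_X_comp: "f \<in> L2_space \<mu> \<Longrightarrow> (\<lambda>\<omega>. f (X \<omega>)) \<in> L2_space P"
  by (rule L2_space_compose[OF measurable_X distr_X])

lemma L2_fst: "f \<in> L2_space \<mu> \<Longrightarrow> (\<lambda>p. f (fst p)) \<in> L2_space (Q k)"
  by (rule L2_space_compose[OF measurable_fst distr_fst])

lemma L2_upd: "f \<in> L2_space \<mu> \<Longrightarrow> (\<lambda>p. f (upd k p)) \<in> L2_space (Q k)"
  by (rule L2_space_compose[OF measurable_upd distr_upd])

lemma representativeI:
  assumes F: "F \<in> L2_space P" and f: "f \<in> borel_measurable \<mu>" and eq: "AE \<omega> in P. F \<omega> = f (X \<omega>)"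
  shows "representative P M X F f"
proof -
  have "(\<lambda>\<omega>. f (X \<omega>)) \<in> L2_space P"
    by (rule L2_space_cong_AE[OF F measurable_compose[OF measurable_X f] eq])
  from L2_space_square[OF this] have "integrable (distr P \<mu> X) (\<lambda>x. (f x)\<^sup>2)"
    using f by (subst integrable_distr_eq) simp_all
  then have "f \<in> L2_space \<mu>"
    using f by (intro L2_spaceI) (simp_all add: distr_X)
  with eq show ?thesis by (simp add: representative_def)
qed

lemma representative_exists:
  assumes "F \<in> L2_X P M X"
  shows "\<exists>f. representative P M X F f"
proof -
  from assms have F: "F \<in> borel_measurable (\<G> UNIV)" "F \<in> L2_space P" by (simp_all add: L2_X_iff)
  from doob_dynkin[OF F(1)] obtain f where "f \<in> borel_measurable \<mu>" "\<And>\<omega>. \<omega> \<in> space P \<Longrightarrow> F \<omega> = f (X \<omega>)"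
    by blast
  with F(2) show ?thesis by (intro exI[of _ f] representativeI AE_I2)
qed

text \<open>The coordinates are independent, so conditioning on all but the k-th means integrating
  that one out. The averaging property is checked on A = X^{-1}(B) with B invariant under changes of
  coordinate k: after resampling, the indicator of B leaves the inner integral.\<close>

lemma cond_exp_upd:
  assumes b: "integrable \<mu> b"
  shows "AE \<omega> in P. real_cond_exp P (\<G> (- {k})) (\<lambda>\<omega>. b (X \<omega>)) \<omega> = (\<integral>y. b ((X \<omega>)(k := y)) \<partial>M k)"
proof -
  interpret pair_sigma_finite \<mu> "M k" ..
  note [measurable] = borel_measurable_integrable[OF b]
  define \<gamma> where "\<gamma> x = (\<integral>y. b (x(k := y)) \<partial>M k)" for x
  have intQ: "integrable (Q k) (\<lambda>p. b (upd k p))"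
    using b by (intro integrable_distr[OF measurable_upd]) (simp add: distr_upd)
  have \<gamma>: "integrable \<mu> \<gamma>"
    unfolding \<gamma>_def using integrable_fst'[OF intQ] by simp
  note [measurable] = borel_measurable_integrable[OF \<gamma>]
  show ?thesis unfolding \<gamma>_def[symmetric]
  proof (rule \<G>.real_cond_exp_charact)
    show "integrable P (\<lambda>\<omega>. b (X \<omega>))" "integrable P (\<lambda>\<omega>. \<gamma> (X \<omega>))"
      using b \<gamma> by (auto intro!: integrable_distr[OF measurable_X] simp: distr_X)
    \<comment> \<open>Component k is read from the second factor, all others from \<open>X\<close>.
      Hence the smaller sigma-algebra without coordinate k suffices.\<close>
    have "(\<lambda>p. (X (fst p))(k := snd p)) \<in> measurable (\<G> (- {k}) \<Otimes>\<^sub>M M k) \<mu>"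
    proof (rule measurable_PiM_single')
      show "(\<lambda>p. ((X (fst p))(k := snd p)) i) \<in> measurable (\<G> (- {k}) \<Otimes>\<^sub>M M k) (M i)" for i
        using measurable_compose[OF measurable_fst measurable_component_G[of i "-{k}"]]
        by (cases "i = k") simp_all
    next
      show "(\<lambda>p i. ((X (fst p))(k := snd p)) i) \<in> space (\<G> (- {k}) \<Otimes>\<^sub>M M k) \<rightarrow> (\<Pi>\<^sub>E i\<in>UNIV. space (M i))"
        using measurable_space[OF measurable_X] by (simp add: space_pair_measure space_PiM PiE_UNIV_domain Pi_iff)
    qed
    then have "(\<lambda>p. b ((X (fst p))(k := snd p))) \<in> borel_measurable (\<G> (- {k}) \<Otimes>\<^sub>M M k)"
      by (rule measurable_compose) simp
    then show "(\<lambda>\<omega>. \<gamma> (X \<omega>)) \<in> borel_measurable (\<G> (- {k}))"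
      unfolding \<gamma>_def by (intro M.borel_measurable_lebesgue_integral) (simp add: split_beta')
    fix A assume "A \<in> sets (\<G> (- {k}))"
    then obtain B where B [measurable]: "B \<in> sets \<mu>" and A: "A = X -` B \<inter> space P"
      and inv: "\<forall>x \<in> space \<mu>. \<forall>j \<in> - (- {k}). \<forall>y \<in> space (M j). x(j := y) \<in> B \<longleftrightarrow> x \<in> B"
      using sets_GD by blast
    have set_int: "(\<integral>\<omega>\<in>A. f (X \<omega>) \<partial>P) = (\<integral>x. indicator B x * f x \<partial>\<mu>)"
      if [measurable]: "f \<in> borel_measurable \<mu>" for f :: "_ \<Rightarrow> real"
      unfolding set_lebesgue_integral_def
      by (subst integral_compose[OF measurable_X distr_X, symmetric])
         (auto intro!: Bochner_Integration.integral_cong simp: A split: split_indicator)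
    have "(\<integral>\<omega>\<in>A. b (X \<omega>) \<partial>P) = (\<integral>x. indicator B x * b x \<partial>\<mu>)"
      by (rule set_int) simp
    also have "\<dots> = (\<integral>p. indicator B (upd k p) * b (upd k p) \<partial>Q k)"
      by (rule integral_compose[OF measurable_upd distr_upd, symmetric]) simp
    also have "\<dots> = (\<integral>p. indicator B (fst p) * b (upd k p) \<partial>Q k)"
      using inv by (intro Bochner_Integration.integral_cong) (simp_all add: space_pair_measure mem_Times_iff indicator_def)
    also have "\<dots> = (\<integral>x. \<integral>y. indicator B x * b (x(k := y)) \<partial>M k \<partial>\<mu>)"
    proof -
      have "integrable (Q k) (\<lambda>p. indicator (B \<times> space (M k)) p *\<^sub>R b (upd k p))"
        by (rule integrable_mult_indicator[OF _ intQ]) simp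
      then have "integrable (Q k) (\<lambda>p. indicator B (fst p) * b (upd k p))"
        by (rule Bochner_Integration.integrable_cong[THEN iffD1, rotated -1])
           (auto simp: space_pair_measure indicator_def)
      from integral_fst'[OF this] show ?thesis by simp
    qed
    also have "\<dots> = (\<integral>x. indicator B x * \<gamma> x \<partial>\<mu>)"
      by (simp add: \<gamma>_def)
    also have "\<dots> = (\<integral>\<omega>\<in>A. \<gamma> (X \<omega>) \<partial>P)"
      by (rule set_int[symmetric]) simp
    finally show "(\<integral>\<omega>\<in>A. b (X \<omega>) \<partial>P) = (\<integral>\<omega>\<in>A. \<gamma> (X \<omega>) \<partial>P)" .
  qed
qed

lemma integral_mult_cond_exp:
  assumes a: "a \<in> L2_space \<mu>" and b: "b \<in> L2_space \<mu>"
  shows "(\<integral>\<omega>. a (X \<omega>) * real_cond_exp P (\<G> (- {k})) (\<lambda>\<omega>. b (X \<omega>)) \<omega> \<partial>P)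
    = (\<integral>p. a (fst p) * b (upd k p) \<partial>Q k)"
proof -
  interpret pair_sigma_finite \<mu> "M k" ..
  note [measurable] = L2_space_measurable[OF a] L2_space_measurable[OF b]
  have intQ: "integrable (Q k) (\<lambda>p. a (fst p) * b (upd k p))"
    by (rule L2_space_mult[OF L2_fst[OF a] L2_upd[OF b]])
  have b1: "integrable \<mu> b" using b by (rule P.L2_space_integrable)
  have "integrable (Q k) (\<lambda>p. b (upd k p))"
    using b1 by (intro integrable_distr[OF measurable_upd]) (simp add: distr_upd)
  from integrable_fst'[OF this] have [measurable]: "(\<lambda>x. \<integral>y. b (x(k := y)) \<partial>M k) \<in> borel_measurable \<mu>"
    by (intro borel_measurable_integrable) simp
  have "(\<integral>\<omega>. a (X \<omega>) * real_cond_exp P (\<G> (- {k})) (\<lambda>\<omega>. b (X \<omega>)) \<omega> \<partial>P)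
      = (\<integral>\<omega>. a (X \<omega>) * (\<integral>y. b ((X \<omega>)(k := y)) \<partial>M k) \<partial>P)"
  proof (rule integral_cong_AE)
    show "AE \<omega> in P. a (X \<omega>) * real_cond_exp P (\<G> (- {k})) (\<lambda>\<omega>. b (X \<omega>)) \<omega>
        = a (X \<omega>) * (\<integral>y. b ((X \<omega>)(k := y)) \<partial>M k)"
      using cond_exp_upd[OF b1, of k] by eventually_elim simp
  qed measurable
  also have "\<dots> = (\<integral>x. a x * (\<integral>y. b (x(k := y)) \<partial>M k) \<partial>\<mu>)"
    by (rule integral_compose[OF measurable_X distr_X]) simp
  also have "\<dots> = (\<integral>p. a (fst p) * b (upd k p) \<partial>Q k)"
    using integral_fst'[OF intQ] by simp
  finally show ?thesis .
qed

lemma integral_Q_swap: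
  fixes \<phi> :: "(nat \<Rightarrow> 'a) \<times> 'a \<Rightarrow> real"
  shows "\<phi> \<in> borel_measurable (Q k) \<Longrightarrow> (\<integral>p. \<phi> (upd k p, fst p k) \<partial>Q k) = (\<integral>p. \<phi> p \<partial>Q k)"
  by (rule integral_compose[OF _ distr_upd_component]) measurable

text \<open>Expanding the right-hand integrand gives two terms equal to E[a b], by invariance of
  \<mu>, and two mixed terms equal to E[a b'], by exchangeability. The left side is E[a b] -
  E[a b'], hence half of the integral.\<close>

lemma integral_D_mult_comp:
  assumes a: "a \<in> L2_space \<mu>" and b: "b \<in> L2_space \<mu>"
  shows "(\<integral>\<omega>. D (\<lambda>\<omega>. a (X \<omega>)) k \<omega> * D (\<lambda>\<omega>. b (X \<omega>)) k \<omega> \<partial>P)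
    = (\<integral>p. (a (upd k p) - a (fst p)) * (b (upd k p) - b (fst p)) \<partial>Q k) / 2"
proof -
  note [measurable] = L2_space_measurable[OF a] L2_space_measurable[OF b]
  note int = L2_space_mult[OF L2_fst[OF a] L2_fst[OF b], of k] L2_space_mult[OF L2_fst[OF a] L2_upd[OF b], of k]
    L2_space_mult[OF L2_upd[OF a] L2_fst[OF b], of k] L2_space_mult[OF L2_upd[OF a] L2_upd[OF b], of k]
  have "(\<integral>p. (a (upd k p) - a (fst p)) * (b (upd k p) - b (fst p)) \<partial>Q k)
    = (\<integral>p. a (upd k p) * b (upd k p) \<partial>Q k) - (\<integral>p. a (upd k p) * b (fst p) \<partial>Q k)
      - (\<integral>p. a (fst p) * b (upd k p) \<partial>Q k) + (\<integral>p. a (fst p) * b (fst p) \<partial>Q k)"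
    using int by (simp add: algebra_simps)
  moreover have "(\<integral>p. a (upd k p) * b (upd k p) \<partial>Q k) = (\<integral>x. a x * b x \<partial>\<mu>)"
    by (rule integral_compose[OF measurable_upd distr_upd]) simp
  moreover have "(\<integral>p. a (fst p) * b (fst p) \<partial>Q k) = (\<integral>x. a x * b x \<partial>\<mu>)"
    by (rule integral_compose[OF measurable_fst distr_fst]) simp
  moreover have "(\<integral>p. a (upd k p) * b (fst p) \<partial>Q k) = (\<integral>p. a (fst p) * b (upd k p) \<partial>Q k)"
    \<comment> \<open>Resampling after the exchange restores the original sequence, so a and b trade
      arguments.\<close>
    using integral_Q_swap[of "\<lambda>p. a (fst p) * b (upd k p)" k] by (simp add: fun_upd_idem)
  moreover have "(\<integral>\<omega>. a (X \<omega>) * b (X \<omega>) \<partial>P) = (\<integral>x. a x * b x \<partial>\<mu>)"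
    by (rule integral_compose[OF measurable_X distr_X]) simp
  moreover note integral_mult_cond_exp[OF a b, of k]
    \<G>.integral_cond_exp_diff_mult[OF L2_X_comp[OF a] L2_X_comp[OF b], of "- {k}"]
  ultimately show ?thesis unfolding mall_D_def by linarith
qed

text \<open>Up to null sets the gradient depends only on the almost sure class of its argument, so F
  and H may be replaced by their representatives.\<close>

lemma integral_D_mult:
  assumes F: "F \<in> borel_measurable P" and H: "H \<in> borel_measurable P"
    and f: "representative P M X F f" and h: "representative P M X H h"
  shows "(\<integral>\<omega>. D F k \<omega> * D H k \<omega> \<partial>P)
    = (\<integral>p. (f (upd k p) - f (fst p)) * (h (upd k p) - h (fst p)) \<partial>Q k) / 2"
proof -
  have L2: "f \<in> L2_space \<mu>" "h \<in> L2_space \<mu>"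
    and AE: "AE \<omega> in P. F \<omega> = f (X \<omega>)" "AE \<omega> in P. H \<omega> = h (X \<omega>)"
    using f h by (simp_all add: representative_def)
  note [measurable] = L2_space_measurable[OF L2(1)] L2_space_measurable[OF L2(2)] F H
  have [measurable]: "D A k \<in> borel_measurable P" if [measurable]: "A \<in> borel_measurable P" for A
    unfolding mall_D_def by measurable
  have "(\<integral>\<omega>. D F k \<omega> * D H k \<omega> \<partial>P) = (\<integral>\<omega>. D (\<lambda>\<omega>. f (X \<omega>)) k \<omega> * D (\<lambda>\<omega>. h (X \<omega>)) k \<omega> \<partial>P)"
  proof (rule integral_cong_AE)
    have "AE \<omega> in P. D F k \<omega> = D (\<lambda>\<omega>. f (X \<omega>)) k \<omega>" "AE \<omega> in P. D H k \<omega> = D (\<lambda>\<omega>. h (X \<omega>)) k \<omega>"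
      using AE by (simp_all add: D_cong)
    then show "AE \<omega> in P. D F k \<omega> * D H k \<omega> = D (\<lambda>\<omega>. f (X \<omega>)) k \<omega> * D (\<lambda>\<omega>. h (X \<omega>)) k \<omega>"
      by eventually_elim simp
  qed simp_all
  then show ?thesis using integral_D_mult_comp[OF L2] by simp
qed

lemma swap_prod_eq:
  "swap_prod X X' f g k \<omega> = (\<lambda>p. (f (upd k p) - f (fst p)) * (g (upd k p) - g (fst p))) (X \<omega>, X' \<omega> k)"
  by (simp add: swap_prod_def)

lemma
  assumes f: "f \<in> L2_space \<mu>" and g: "g \<in> L2_space \<mu>"
  shows integrable_swap_prod: "integrable P (swap_prod X X' f g k)"
    and integral_swap_prod: "h \<in> borel_measurable \<mu> \<Longrightarrow> (\<integral>\<omega>. h (X \<omega>) * swap_prod X X' f g k \<omega> \<partial>P)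
      = (\<integral>p. h (fst p) * ((f (upd k p) - f (fst p)) * (g (upd k p) - g (fst p))) \<partial>Q k)"
proof -
  note [measurable] = L2_space_measurable[OF f] L2_space_measurable[OF g]
  have "integrable (Q k) (\<lambda>p. (f (upd k p) - f (fst p)) * (g (upd k p) - g (fst p)))"
    using f g by (intro L2_space_mult L2_space_diff L2_upd L2_fst)
  then have "integrable P (\<lambda>\<omega>. (\<lambda>p. (f (upd k p) - f (fst p)) * (g (upd k p) - g (fst p))) (X \<omega>, X' \<omega> k))"
    by (intro integrable_distr[OF measurable_pair_X_X']) (simp only: distr_X_X')
  then show "integrable P (swap_prod X X' f g k)"
    unfolding swap_prod_eq[abs_def] .
  assume [measurable]: "h \<in> borel_measurable \<mu>"
  have "(\<integral>\<omega>. (\<lambda>p. h (fst p) * ((f (upd k p) - f (fst p)) * (g (upd k p) - g (fst p)))) (X \<omega>, X' \<omega> k) \<partial>P)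
    = (\<integral>p. h (fst p) * ((f (upd k p) - f (fst p)) * (g (upd k p) - g (fst p))) \<partial>Q k)"
    by (rule integral_compose[OF measurable_pair_X_X' distr_X_X']) measurable
  then show "(\<integral>\<omega>. h (X \<omega>) * swap_prod X X' f g k \<omega> \<partial>P)
      = (\<integral>p. h (fst p) * ((f (upd k p) - f (fst p)) * (g (upd k p) - g (fst p))) \<partial>Q k)"
    by (simp add: swap_prod_eq)
qed

subsection \<open>The domain of the gradient and the divergence\<close>

abbreviation q :: "('w \<Rightarrow> real) \<Rightarrow> ennreal" where "q \<equiv> nn_square P"

text \<open>The squared norm of a process in L2 of counting measure times P, written as a series in
  [0, \<infinity>]; see \<open>nn_square_kP\<close>.\<close>

abbreviation energy :: "(nat \<Rightarrow> 'w \<Rightarrow> real) \<Rightarrow> ennreal" where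
  "energy U \<equiv> \<Sum>k. q (U k)"

section \<open>Norms of processes and of gradients\<close>

lemma measurable_kP_iff:
  "case_prod U \<in> borel_measurable (kP P M X) \<longleftrightarrow> (\<forall>k. U k \<in> borel_measurable (\<G> UNIV))"
proof
  assume [measurable]: "case_prod U \<in> borel_measurable (kP P M X)"
  show "\<forall>k. U k \<in> borel_measurable (\<G> UNIV)"
  proof
    fix k
    have "(\<lambda>\<omega>. (k, \<omega>)) \<in> measurable (P_F P M X) (kP P M X)" unfolding kP_def by simp
    from measurable_compose[OF this \<open>case_prod U \<in> _\<close>] show "U k \<in> borel_measurable (\<G> UNIV)"
      by (simp add: measurable_cong_sets[OF sets_P_F])
  qed
next
  assume "\<forall>k. U k \<in> borel_measurable (\<G> UNIV)"
  then show "case_prod U \<in> borel_measurable (kP P M X)"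
    unfolding kP_def
    by (intro measurable_pair_measure_countable1) (simp_all add: measurable_cong_sets[OF sets_P_F])
qed

lemma nn_square_kP:
  assumes "\<And>k. U k \<in> borel_measurable (\<G> UNIV)"
  shows "nn_square (kP P M X) (case_prod U) = energy U"
proof -
  interpret F: prob_space "P_F P M X" by (rule prob_space_P_F)
  have [measurable]: "case_prod U \<in> borel_measurable (count_space UNIV \<Otimes>\<^sub>M P_F P M X)"
    using measurable_kP_iff[of U] assms unfolding kP_def by blast
  have "nn_square (kP P M X) (case_prod U)
    = (\<integral>\<^sup>+k. \<integral>\<^sup>+\<omega>. ennreal ((U k \<omega>)\<^sup>2) \<partial>P_F P M X \<partial>count_space UNIV)"
    unfolding nn_square_def kP_def by (subst F.nn_integral_fst[symmetric]) simp_all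
  also have "\<dots> = energy U"
    using assms by (simp add: nn_integral_count_space_nat nn_square_def nn_integral_P_F)
  finally show ?thesis .
qed

lemma L2_proc_iff:
  "U \<in> L2_proc P M X \<longleftrightarrow> (\<forall>k. U k \<in> borel_measurable (\<G> UNIV)) \<and> energy U < \<infinity>"
  using nn_square_kP[of U] by (auto simp: L2_proc_def L2_space_iff_nn_square measurable_kP_iff)

lemma L2_nrm_kP:
  assumes "\<And>k. U k \<in> borel_measurable (\<G> UNIV)"
  shows "L2_nrm (kP P M X) (case_prod U) = sqrt (enn2real (energy U))"
  using assms nn_square_kP[of U] by (subst L2_nrm_eq) (simp_all add: measurable_kP_iff)

lemma L2_nrm_P_F:
  "F \<in> borel_measurable (\<G> UNIV) \<Longrightarrow> L2_nrm (P_F P M X) F = L2_nrm P F"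
  unfolding L2_nrm_def by (simp add: integral_P_F)

lemma q_le_energy: "q (U k) \<le> energy U"
  using sum_le_suminf[of "\<lambda>k. q (U k)" "{k}"] by simp

lemma energy_lin:
  assumes "\<And>k. U k \<in> borel_measurable P" "\<And>k. V k \<in> borel_measurable P"
  shows "energy (\<lambda>k \<omega>. c * U k \<omega> + d * V k \<omega>) \<le> ennreal (2 * c\<^sup>2) * energy U + ennreal (2 * d\<^sup>2) * energy V"
proof -
  have "energy (\<lambda>k \<omega>. c * U k \<omega> + d * V k \<omega>)
      \<le> (\<Sum>k. ennreal (2 * c\<^sup>2) * q (U k) + ennreal (2 * d\<^sup>2) * q (V k))"
    using assms by (intro suminf_le nn_square_lin) auto
  also have "\<dots> = ennreal (2 * c\<^sup>2) * energy U + ennreal (2 * d\<^sup>2) * energy V"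
    by (simp add: suminf_add[symmetric])
  finally show ?thesis .
qed

lemma D_measurable_P: "F \<in> borel_measurable P \<Longrightarrow> D F k \<in> borel_measurable P"
  unfolding mall_D_def by (intro borel_measurable_diff borel_measurable_cond_exp2)

lemma q_D_le: "F \<in> L2_space P \<Longrightarrow> q (D F k) \<le> q F"
  using D_square_le[of F k] by (simp add: nn_square_eq D_L2 ennreal_leI)

lemma energy_D_lin:
  assumes "F \<in> L2_space P" "H \<in> L2_space P"
  shows "energy (D (\<lambda>\<omega>. c * F \<omega> + d * H \<omega>)) = energy (\<lambda>k \<omega>. c * D F k \<omega> + d * D H k \<omega>)"
  using assms by (intro suminf_cong nn_square_cong D_lin)

lemma energy_D_lin_le:
  assumes "F \<in> L2_space P" "H \<in> L2_space P"
  shows "energy (D (\<lambda>\<omega>. c * F \<omega> + d * H \<omega>)) \<le> ennreal (2 * c\<^sup>2) * energy (D F) + ennreal (2 * d\<^sup>2) * energy (D H)"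
  unfolding energy_D_lin[OF assms] by (intro energy_lin D_measurable_P L2_space_measurable assms)

text \<open>For k > m the factor H leaves D_k, which costs C^2 per term. For each of the m + 1
  coordinates k \<le> m the contraction property bounds the term by the squared norm of H F, which
  explains the factor \<open>Suc m\<close>.\<close>

lemma energy_D_mult:
  assumes F: "F \<in> L2_space P" and H: "H \<in> borel_measurable (\<G> {..m})" "\<And>\<omega>. \<bar>H \<omega>\<bar> \<le> C"
  shows "energy (D (\<lambda>\<omega>. H \<omega> * F \<omega>)) \<le> ennreal (real (Suc m) * C\<^sup>2) * q F + ennreal (C\<^sup>2) * energy (D F)"
proof -
  have HF: "(\<lambda>\<omega>. H \<omega> * F \<omega>) \<in> L2_space P"
    by (rule L2_space_bounded_mult[OF F measurable_G_P[OF H(1)] H(2)])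
  have meas: "F \<in> borel_measurable P" using F by (rule L2_space_measurable)
  have "q (D (\<lambda>\<omega>. H \<omega> * F \<omega>) k) \<le> (if k \<in> {..m} then ennreal (C\<^sup>2) * q F else 0) + ennreal (C\<^sup>2) * q (D F k)" for k
  proof (cases "k \<le> m")
    case True
    have "q (D (\<lambda>\<omega>. H \<omega> * F \<omega>) k) \<le> ennreal (C\<^sup>2) * q F"
      using q_D_le[OF HF] nn_square_bounded_mult[OF meas H(2)] by (rule order_trans)
    with True show ?thesis by (simp add: add_increasing2)
  next
    case False
    have "AE \<omega> in P. D (\<lambda>\<omega>. H \<omega> * F \<omega>) k \<omega> = H \<omega> * D F k \<omega>"
      using False by (intro D_mult[OF Om.L2_space_integrable[OF HF] meas H(1)]) simp
    then have "q (D (\<lambda>\<omega>. H \<omega> * F \<omega>) k) = q (\<lambda>\<omega>. H \<omega> * D F k \<omega>)" by (rule nn_square_cong)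
    with False show ?thesis
      using nn_square_bounded_mult[OF D_measurable_P[OF meas, of k] H(2)] by simp
  qed
  then have "energy (D (\<lambda>\<omega>. H \<omega> * F \<omega>))
      \<le> (\<Sum>k. (if k \<in> {..m} then ennreal (C\<^sup>2) * q F else 0) + ennreal (C\<^sup>2) * q (D F k))"
    by (intro suminf_le) auto
  also have "\<dots> = (\<Sum>k. if k \<in> {..m} then ennreal (C\<^sup>2) * q F else 0) + ennreal (C\<^sup>2) * energy (D F)"
    by (simp add: suminf_add[symmetric])
  also have "(\<Sum>k. if k \<in> {..m} then ennreal (C\<^sup>2) * q F else 0) = (\<Sum>k\<le>m. ennreal (C\<^sup>2) * q F)"
    by (subst suminf_finite[of "{..m}"]) simp_all
  also have "\<dots> = ennreal (real (Suc m) * C\<^sup>2) * q F"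
    by (simp add: ennreal_of_nat_eq_real_of_nat ennreal_mult mult.assoc)
  finally show ?thesis .
qed

lemma cyl_S_iff: "F \<in> cyl_S P M X \<longleftrightarrow> F \<in> L2_space P \<and> (\<exists>n. F \<in> borel_measurable (\<G> {..n}))"
  unfolding cyl_S_def mem_Collect_eq L2_X_iff using measurable_G_mono[OF subset_UNIV] by blast

lemma cyl_S_L2_X: "F \<in> cyl_S P M X \<Longrightarrow> F \<in> L2_X P M X"
  by (simp add: cyl_S_def)

lemma cyl_S_lin:
  assumes "F \<in> cyl_S P M X" "H \<in> cyl_S P M X"
  shows "(\<lambda>\<omega>. c * F \<omega> + d * H \<omega>) \<in> cyl_S P M X"
proof -
  obtain m n where "F \<in> borel_measurable (\<G> {..m})" "H \<in> borel_measurable (\<G> {..n})"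
    using assms by (auto simp: cyl_S_iff)
  then have "F \<in> borel_measurable (\<G> {..max m n})" "H \<in> borel_measurable (\<G> {..max m n})"
    by (auto intro: measurable_G_mono[rotated])
  then have "(\<lambda>\<omega>. c * F \<omega> + d * H \<omega>) \<in> borel_measurable (\<G> {..max m n})" by simp
  with assms show ?thesis using L2_space_lin[of F P H c d] by (auto simp: cyl_S_iff)
qed

lemma cyl_S_mult:
  assumes F: "F \<in> cyl_S P M X" and H: "H \<in> borel_measurable (\<G> {..m})" "\<And>\<omega>. \<bar>H \<omega>\<bar> \<le> C"
  shows "(\<lambda>\<omega>. H \<omega> * F \<omega>) \<in> cyl_S P M X"
proof -
  obtain n where "F \<in> borel_measurable (\<G> {..n})"
    using F by (auto simp: cyl_S_iff)
  then have "F \<in> borel_measurable (\<G> {..max m n})" "H \<in> borel_measurable (\<G> {..max m n})"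
    using H(1) by (auto elim!: measurable_G_mono[rotated])
  then have "(\<lambda>\<omega>. H \<omega> * F \<omega>) \<in> borel_measurable (\<G> {..max m n})" by simp
  with F show ?thesis
    using L2_space_bounded_mult[OF _ measurable_G_P[OF H(1)] H(2), of F] by (auto simp: cyl_S_iff)
qed

text \<open>Only finitely many D_k F differ from 0, and each lies in L2.\<close>

lemma energy_cyl_S:
  assumes "F \<in> cyl_S P M X"
  shows "energy (D F) < \<infinity>"
proof -
  obtain n where F: "F \<in> L2_space P" "F \<in> borel_measurable (\<G> {..n})"
    using assms by (auto simp: cyl_S_iff)
  have "q (D F k) = 0" if "k \<notin> {..n}" for k
  proof -
    have "AE \<omega> in P. D F k \<omega> = 0"
      using that by (intro D_eq_0[OF Om.L2_space_integrable[OF F(1)] F(2)]) simp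
    then show ?thesis
      by (subst nn_square_eq_0_iff) (intro D_measurable_P L2_space_measurable F)
  qed
  then have "energy (D F) = (\<Sum>k\<le>n. q (D F k))" by (intro suminf_finite) simp_all
  also have "\<dots> < \<infinity>"
    using D_L2[OF F(1)] by (simp add: L2_space_iff_nn_square)
  finally show ?thesis .
qed

text \<open>Writing F = S n - (S n - F), one n for which the second part has energy below 1 is
  enough.\<close>

lemma energy_D_finite_of_cyl_S_approx:
  assumes F: "F \<in> L2_space P" and S: "\<And>n. S n \<in> cyl_S P M X"
    and lim: "(\<lambda>n. energy (D (\<lambda>\<omega>. S n \<omega> - F \<omega>))) \<longlonglongrightarrow> 0"
  shows "energy (D F) < \<infinity>"
proof -
  from order_tendstoD(2)[OF lim, of 1] obtain n where n: "energy (D (\<lambda>\<omega>. S n \<omega> - F \<omega>)) < 1"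
    by (auto simp: eventually_sequentially)
  have SL2: "S n \<in> L2_space P" using S[of n] by (simp add: cyl_S_iff)
  have "energy (D F) \<le> ennreal (2 * 1\<^sup>2) * energy (D (S n)) + ennreal (2 * (-1)\<^sup>2) * energy (D (\<lambda>\<omega>. S n \<omega> - F \<omega>))"
    using energy_D_lin_le[OF SL2 L2_space_diff[OF SL2 F], of 1 "-1"] by simp
  also have "\<dots> < \<infinity>"
    using energy_cyl_S[OF S[of n]] n by (auto simp: ennreal_mult_less_top intro: less_trans)
  finally show ?thesis .
qed

text \<open>This contains the closability of \<open>D\<close>: every D_k is continuous on L2, so the
  limit process U of an approximating sequence agrees almost surely with \<open>D F\<close>,
  coordinate by coordinate. The existential over U disappears, and norms become extended squared
  norms under P.\<close>

lemma dom_D_iff: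
  "F \<in> dom_D P M X \<longleftrightarrow> F \<in> L2_X P M X \<and> (\<exists>S. (\<forall>n. S n \<in> cyl_S P M X) \<and>
    (\<lambda>n. q (\<lambda>\<omega>. S n \<omega> - F \<omega>)) \<longlonglongrightarrow> 0 \<and> (\<lambda>n. energy (D (\<lambda>\<omega>. S n \<omega> - F \<omega>))) \<longlonglongrightarrow> 0)"
  (is "?L \<longleftrightarrow> ?R")
proof -
  have diff: "energy (D (\<lambda>\<omega>. S \<omega> - F \<omega>)) = energy (\<lambda>k \<omega>. D S k \<omega> - D F k \<omega>)"
    if "F \<in> L2_X P M X" "S \<in> cyl_S P M X" for F S
    using energy_D_lin[of S F 1 "-1"] that by (simp add: L2_X_iff cyl_S_iff)
  have conv: "(\<lambda>n. L2_nrm (P_F P M X) (\<lambda>\<omega>. S n \<omega> - F \<omega>)) \<longlonglongrightarrow> 0 \<longleftrightarrow> (\<lambda>n. q (\<lambda>\<omega>. S n \<omega> - F \<omega>)) \<longlonglongrightarrow> 0"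
    if F: "F \<in> L2_X P M X" and S: "\<And>n. S n \<in> cyl_S P M X" for F S
  proof -
    have SF: "(\<lambda>\<omega>. S n \<omega> - F \<omega>) \<in> L2_space P" for n
      using F S[of n] by (intro L2_space_diff) (simp_all add: L2_X_iff cyl_S_iff)
    have "(\<lambda>\<omega>. S n \<omega> - F \<omega>) \<in> borel_measurable (\<G> UNIV)" for n
      using F cyl_S_L2_X[OF S[of n]] by (intro borel_measurable_diff) (simp_all add: L2_X_iff)
    then have "L2_nrm (P_F P M X) (\<lambda>\<omega>. S n \<omega> - F \<omega>) = sqrt (enn2real (q (\<lambda>\<omega>. S n \<omega> - F \<omega>)))" for n
      using L2_space_measurable[OF SF] by (subst L2_nrm_P_F) (simp_all add: L2_nrm_eq)
    then show ?thesis
      using SF by (simp only:) (intro tendsto_sqrt_enn2real_0_iff, simp add: L2_space_iff_nn_square)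
  qed
  have convk: "(\<lambda>n. L2_nrm (kP P M X) (\<lambda>(k, \<omega>). D (S n) k \<omega> - U k \<omega>)) \<longlonglongrightarrow> 0
      \<longleftrightarrow> (\<lambda>n. energy (\<lambda>k \<omega>. D (S n) k \<omega> - U k \<omega>)) \<longlonglongrightarrow> 0"
    if U: "U \<in> L2_proc P M X" and S: "\<And>n. D (S n) \<in> L2_proc P M X" for U S
  proof -
    have meas: "D (S n) k \<in> borel_measurable (\<G> UNIV)" "U k \<in> borel_measurable (\<G> UNIV)" for n k
      using U S[of n] by (simp_all add: L2_proc_iff)
    have "energy (\<lambda>k \<omega>. D (S n) k \<omega> - U k \<omega>) < \<infinity>" for n
      using energy_lin[of "D (S n)" U 1 "-1"] meas[THEN measurable_G_P] U S[of n]
      by (simp add: L2_proc_iff) (auto simp: ennreal_mult_less_top elim!: le_less_trans)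
    moreover have "L2_nrm (kP P M X) (\<lambda>(k, \<omega>). D (S n) k \<omega> - U k \<omega>)
        = sqrt (enn2real (energy (\<lambda>k \<omega>. D (S n) k \<omega> - U k \<omega>)))" for n
      using meas by (intro L2_nrm_kP) simp
    ultimately show ?thesis
      by (simp only:) (intro tendsto_sqrt_enn2real_0_iff)
  qed
  have DS: "D S \<in> L2_proc P M X" if "S \<in> cyl_S P M X" for S
    using energy_cyl_S[OF that] cyl_S_L2_X[OF that] by (simp add: L2_proc_iff L2_X_iff D_measurable)
  show ?thesis
  proof
    assume ?L
    then obtain U S where F: "F \<in> L2_X P M X" and U: "U \<in> L2_proc P M X" and S: "\<And>n. S n \<in> cyl_S P M X"
      and "(\<lambda>n. L2_nrm (P_F P M X) (\<lambda>\<omega>. S n \<omega> - F \<omega>)) \<longlonglongrightarrow> 0"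
      and "(\<lambda>n. L2_nrm (kP P M X) (\<lambda>(k, \<omega>). D (S n) k \<omega> - U k \<omega>)) \<longlonglongrightarrow> 0"
      unfolding dom_D_def by blast
    then have lim: "(\<lambda>n. q (\<lambda>\<omega>. S n \<omega> - F \<omega>)) \<longlonglongrightarrow> 0"
      and limk: "(\<lambda>n. energy (\<lambda>k \<omega>. D (S n) k \<omega> - U k \<omega>)) \<longlonglongrightarrow> 0"
      using conv[OF F S] convk[OF U DS[OF S]] by simp_all
    have FL2: "F \<in> L2_space P" and SL2: "\<And>n. S n \<in> L2_space P"
      using F S by (simp_all add: L2_X_iff cyl_S_iff)
    have Um: "U k \<in> borel_measurable P" for k
      using U measurable_G_P by (auto simp: L2_proc_iff)
    have DU: "AE \<omega> in P. D F k \<omega> = U k \<omega>" for k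
    proof -
      \<comment> \<open>The difference is split at D_k (S n). One part is controlled by the
        contraction D_k applied to S n - F, the other is a single term of the energy. The left side
        does not depend on n, so it is 0.\<close>
      have le: "q (\<lambda>\<omega>. D F k \<omega> - U k \<omega>)
          \<le> ennreal 2 * q (\<lambda>\<omega>. S n \<omega> - F \<omega>) + ennreal 2 * energy (\<lambda>k \<omega>. D (S n) k \<omega> - U k \<omega>)" for n
      proof -
        have meas: "D F k \<in> borel_measurable P" "D (S n) k \<in> borel_measurable P"
          by (intro D_measurable_P L2_space_measurable FL2 SL2)+
        have "q (\<lambda>\<omega>. D F k \<omega> - U k \<omega>)
            = q (\<lambda>\<omega>. (-1) * (D (S n) k \<omega> - D F k \<omega>) + 1 * (D (S n) k \<omega> - U k \<omega>))" by simp
        also have "\<dots> \<le> ennreal (2 * (-1)\<^sup>2) * q (\<lambda>\<omega>. D (S n) k \<omega> - D F k \<omega>)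
            + ennreal (2 * 1\<^sup>2) * q (\<lambda>\<omega>. D (S n) k \<omega> - U k \<omega>)"
          using meas Um by (intro nn_square_lin) simp_all
        also have "q (\<lambda>\<omega>. D (S n) k \<omega> - D F k \<omega>) = q (D (\<lambda>\<omega>. S n \<omega> - F \<omega>) k)"
          using D_lin[OF SL2[of n] FL2, of 1 "-1" k] by (intro nn_square_cong) auto
        also have "\<dots> \<le> q (\<lambda>\<omega>. S n \<omega> - F \<omega>)"
          by (intro q_D_le L2_space_diff SL2 FL2)
        also have "q (\<lambda>\<omega>. D (S n) k \<omega> - U k \<omega>) \<le> energy (\<lambda>k \<omega>. D (S n) k \<omega> - U k \<omega>)"
          by (rule q_le_energy)
        finally show ?thesis by (simp add: mult_left_mono add_mono)
      qed
      from tendsto_0_lin_ennreal[OF lim limk this] have "q (\<lambda>\<omega>. D F k \<omega> - U k \<omega>) = 0"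
        by (simp add: LIMSEQ_const_iff)
      moreover have "(\<lambda>\<omega>. D F k \<omega> - U k \<omega>) \<in> borel_measurable P"
        by (intro borel_measurable_diff D_measurable_P L2_space_measurable FL2 Um)
      ultimately show ?thesis by (simp add: nn_square_eq_0_iff)
    qed
    have "energy (D (\<lambda>\<omega>. S n \<omega> - F \<omega>)) = energy (\<lambda>k \<omega>. D (S n) k \<omega> - U k \<omega>)" for n
      unfolding diff[OF F S]
    proof (intro suminf_cong nn_square_cong)
      show "AE \<omega> in P. D (S n) k \<omega> - D F k \<omega> = D (S n) k \<omega> - U k \<omega>" for k
        using DU[of k] by eventually_elim simp
    qed
    with limk lim F S show ?R by (intro conjI exI[of _ S]) simp_all
  next
    assume ?R
    then obtain S where F: "F \<in> L2_X P M X" and S: "\<And>n. S n \<in> cyl_S P M X"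
      and lim: "(\<lambda>n. q (\<lambda>\<omega>. S n \<omega> - F \<omega>)) \<longlonglongrightarrow> 0"
      and limk: "(\<lambda>n. energy (D (\<lambda>\<omega>. S n \<omega> - F \<omega>))) \<longlonglongrightarrow> 0" by blast
    have FL2: "F \<in> L2_space P" and SL2: "\<And>n. S n \<in> L2_space P"
      using F S by (simp_all add: L2_X_iff cyl_S_iff)
    \<comment> \<open>\<open>D F\<close> itself serves as the limit process that the definition asks
      for.\<close>
    have DF: "D F \<in> L2_proc P M X"
      using F energy_D_finite_of_cyl_S_approx[OF FL2 S limk] by (simp add: L2_proc_iff L2_X_iff D_measurable)
    show ?L
      unfolding dom_D_def
    proof (intro CollectI conjI bexI exI allI)
      show "(\<lambda>n. L2_nrm (kP P M X) (\<lambda>(k, \<omega>). D (S n) k \<omega> - D F k \<omega>)) \<longlonglongrightarrow> 0"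
        using limk convk[OF DF DS[OF S]] diff[OF F S] by simp
      show "(\<lambda>n. L2_nrm (P_F P M X) (\<lambda>\<omega>. S n \<omega> - F \<omega>)) \<longlonglongrightarrow> 0"
        using lim conv[OF F S] by simp
    qed (intro F S DF DS)+
  qed
qed

lemma dom_D_L2_X: "F \<in> dom_D P M X \<Longrightarrow> F \<in> L2_X P M X"
  by (simp add: dom_D_def)

lemma dom_D_L2: "F \<in> dom_D P M X \<Longrightarrow> F \<in> L2_space P"
  using dom_D_L2_X L2_X_iff by blast

text \<open>The constant sequence approximates F. The gradient of the zero function is a chosen
  version of 0, and the contraction bound shows that its norm vanishes.\<close>

lemma cyl_S_subset_dom_D: "F \<in> cyl_S P M X \<Longrightarrow> F \<in> dom_D P M X"
proof -
  assume F: "F \<in> cyl_S P M X"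
  then have "(\<lambda>_. 0) \<in> cyl_S P M X" using cyl_S_lin[of F F 0 0] by simp
  then have "q (D (\<lambda>_. 0) k) = 0" for k
    using q_D_le[of "\<lambda>_. 0" k] by (simp add: cyl_S_iff nn_square_def)
  with F show ?thesis
    unfolding dom_D_iff
    by (intro conjI exI[of _ "\<lambda>_. F"]) (simp_all add: cyl_S_L2_X nn_square_def)
qed

lemma dom_D_lin:
  assumes F: "F \<in> dom_D P M X" and H: "H \<in> dom_D P M X"
  shows "(\<lambda>\<omega>. c * F \<omega> + d * H \<omega>) \<in> dom_D P M X"
proof -
  note FL2 = dom_D_L2[OF F] and HL2 = dom_D_L2[OF H]
  obtain S where S: "\<And>n. S n \<in> cyl_S P M X" "(\<lambda>n. q (\<lambda>\<omega>. S n \<omega> - F \<omega>)) \<longlonglongrightarrow> 0"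
    "(\<lambda>n. energy (D (\<lambda>\<omega>. S n \<omega> - F \<omega>))) \<longlonglongrightarrow> 0"
    using F by (auto simp: dom_D_iff)
  obtain T where T: "\<And>n. T n \<in> cyl_S P M X" "(\<lambda>n. q (\<lambda>\<omega>. T n \<omega> - H \<omega>)) \<longlonglongrightarrow> 0"
    "(\<lambda>n. energy (D (\<lambda>\<omega>. T n \<omega> - H \<omega>))) \<longlonglongrightarrow> 0"
    using H by (auto simp: dom_D_iff)
  have SL2: "(\<lambda>\<omega>. S n \<omega> - F \<omega>) \<in> L2_space P" and TL2: "(\<lambda>\<omega>. T n \<omega> - H \<omega>) \<in> L2_space P" for n
    using S(1)[of n] T(1)[of n] by (simp_all add: L2_space_diff FL2 HL2 cyl_S_iff)
  have eq: "(\<lambda>\<omega>. (c * S n \<omega> + d * T n \<omega>) - (c * F \<omega> + d * H \<omega>))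
      = (\<lambda>\<omega>. c * (S n \<omega> - F \<omega>) + d * (T n \<omega> - H \<omega>))" for n
    by (simp add: algebra_simps)
  show ?thesis
    unfolding dom_D_iff
  proof (intro conjI exI[of _ "\<lambda>n \<omega>. c * S n \<omega> + d * T n \<omega>"] allI)
    have "(\<lambda>\<omega>. c * F \<omega> + d * H \<omega>) \<in> borel_measurable (\<G> UNIV)"
      using dom_D_L2_X[OF F] dom_D_L2_X[OF H]
      by (intro borel_measurable_add borel_measurable_times borel_measurable_const) (simp_all add: L2_X_iff)
    then show "(\<lambda>\<omega>. c * F \<omega> + d * H \<omega>) \<in> L2_X P M X"
      using L2_space_lin[OF FL2 HL2] by (simp add: L2_X_iff)
    show "(\<lambda>\<omega>. c * S n \<omega> + d * T n \<omega>) \<in> cyl_S P M X" for n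
      by (intro cyl_S_lin S T)
    show "(\<lambda>n. q (\<lambda>\<omega>. (c * S n \<omega> + d * T n \<omega>) - (c * F \<omega> + d * H \<omega>))) \<longlonglongrightarrow> 0"
      unfolding eq by (rule tendsto_0_lin_ennreal[OF S(2) T(2), where a = "2 * c\<^sup>2" and b = "2 * d\<^sup>2"])
        (intro nn_square_lin L2_space_measurable SL2 TL2)
    show "(\<lambda>n. energy (D (\<lambda>\<omega>. (c * S n \<omega> + d * T n \<omega>) - (c * F \<omega> + d * H \<omega>)))) \<longlonglongrightarrow> 0"
      unfolding eq by (rule tendsto_0_lin_ennreal[OF S(3) T(3), where a = "2 * c\<^sup>2" and b = "2 * d\<^sup>2"]) (intro energy_D_lin_le SL2 TL2)
  qed
qed

text \<open>Multiplying an approximating sequence of F by H approximates H F, and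
  \<open>energy_D_mult\<close> applied to S n - F bounds the gradient error. This admits H F as a
  test function for the divergence.\<close>

lemma dom_D_bounded_mult:
  assumes F: "F \<in> dom_D P M X" and H: "H \<in> borel_measurable (\<G> {..m})" "\<And>\<omega>. \<bar>H \<omega>\<bar> \<le> C"
  shows "(\<lambda>\<omega>. H \<omega> * F \<omega>) \<in> dom_D P M X"
proof -
  note FL2 = dom_D_L2[OF F] and HP = measurable_G_P[OF H(1)]
  obtain S where S: "\<And>n. S n \<in> cyl_S P M X" "(\<lambda>n. q (\<lambda>\<omega>. S n \<omega> - F \<omega>)) \<longlonglongrightarrow> 0"
    "(\<lambda>n. energy (D (\<lambda>\<omega>. S n \<omega> - F \<omega>))) \<longlonglongrightarrow> 0"
    using F by (auto simp: dom_D_iff)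
  have SL2: "(\<lambda>\<omega>. S n \<omega> - F \<omega>) \<in> L2_space P" for n
    using S(1)[of n] by (simp add: L2_space_diff FL2 cyl_S_iff)
  have eq: "(\<lambda>\<omega>. H \<omega> * S n \<omega> - H \<omega> * F \<omega>) = (\<lambda>\<omega>. H \<omega> * (S n \<omega> - F \<omega>))" for n
    by (simp add: algebra_simps)
  show ?thesis
    unfolding dom_D_iff
  proof (intro conjI exI[of _ "\<lambda>n \<omega>. H \<omega> * S n \<omega>"] allI)
    have "(\<lambda>\<omega>. H \<omega> * F \<omega>) \<in> borel_measurable (\<G> UNIV)"
      using dom_D_L2_X[OF F] measurable_G_mono[OF subset_UNIV H(1)]
      by (intro borel_measurable_times) (simp_all add: L2_X_iff)
    then show "(\<lambda>\<omega>. H \<omega> * F \<omega>) \<in> L2_X P M X"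
      using L2_space_bounded_mult[OF FL2 HP H(2)] by (simp add: L2_X_iff)
    show "(\<lambda>\<omega>. H \<omega> * S n \<omega>) \<in> cyl_S P M X" for n
      by (rule cyl_S_mult[OF S(1) H])
    show "(\<lambda>n. q (\<lambda>\<omega>. H \<omega> * S n \<omega> - H \<omega> * F \<omega>)) \<longlonglongrightarrow> 0"
      unfolding eq
    proof (rule tendsto_0_lin_ennreal[OF S(2) S(2), where b = 0])
      show "q (\<lambda>\<omega>. H \<omega> * (S n \<omega> - F \<omega>)) \<le> ennreal (C\<^sup>2) * q (\<lambda>\<omega>. S n \<omega> - F \<omega>) + ennreal 0 * q (\<lambda>\<omega>. S n \<omega> - F \<omega>)" for n
        using nn_square_bounded_mult[OF L2_space_measurable[OF SL2] H(2)] by simp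
    qed
    show "(\<lambda>n. energy (D (\<lambda>\<omega>. H \<omega> * S n \<omega> - H \<omega> * F \<omega>))) \<longlonglongrightarrow> 0"
      unfolding eq by (rule tendsto_0_lin_ennreal[OF S(2) S(3)]) (rule energy_D_mult[OF SL2 H])
  qed
qed

lemma D_L2_proc:
  assumes F: "F \<in> dom_D P M X"
  shows "D F \<in> L2_proc P M X"
proof -
  note FL2 = dom_D_L2[OF F]
  obtain S where S: "\<And>n. S n \<in> cyl_S P M X" "(\<lambda>n. energy (D (\<lambda>\<omega>. S n \<omega> - F \<omega>))) \<longlonglongrightarrow> 0"
    using F by (auto simp: dom_D_iff)
  have "energy (D F) < \<infinity>"
    by (rule energy_D_finite_of_cyl_S_approx[OF FL2 S])
  then show ?thesis
    using dom_D_L2_X[OF F] by (simp add: L2_proc_iff L2_X_iff D_measurable)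
qed

section \<open>The duality pairing and the divergence\<close>

lemma L2_proc_L2: "U \<in> L2_proc P M X \<Longrightarrow> U k \<in> L2_space P"
  using measurable_G_P[of "U k" UNIV borel] le_less_trans[OF q_le_energy[of U k]]
  by (simp add: L2_proc_iff L2_space_iff_nn_square)

lemma summable_L2_proc:
  assumes "U \<in> L2_proc P M X"
  shows "summable (\<lambda>k. \<integral>\<omega>. (U k \<omega>)\<^sup>2 \<partial>P)"
proof (rule summable_suminf_not_top)
  show "(\<Sum>k. ennreal (\<integral>\<omega>. (U k \<omega>)\<^sup>2 \<partial>P)) \<noteq> \<top>"
    using assms L2_proc_L2[OF assms] by (auto simp: L2_proc_iff simp flip: nn_square_eq)
qed simp

lemma summable_pairing:
  assumes U: "U \<in> L2_proc P M X" and V: "V \<in> L2_proc P M X"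
  shows "summable (\<lambda>k. \<integral>\<omega>. U k \<omega> * V k \<omega> \<partial>P)"
proof (rule summable_comparison_test')
  show "summable (\<lambda>k. (\<integral>\<omega>. (U k \<omega>)\<^sup>2 \<partial>P) + (\<integral>\<omega>. (V k \<omega>)\<^sup>2 \<partial>P))"
    by (intro summable_add summable_L2_proc U V)
  show "norm (\<integral>\<omega>. U k \<omega> * V k \<omega> \<partial>P) \<le> (\<integral>\<omega>. (U k \<omega>)\<^sup>2 \<partial>P) + (\<integral>\<omega>. (V k \<omega>)\<^sup>2 \<partial>P)" for k
    unfolding real_norm_def
    by (rule order_trans[OF integral_abs_bound integral_mult_le_squares[OF L2_proc_L2[OF U] L2_proc_L2[OF V]]])
qed

lemma dual_pairing_lin:
  assumes F: "F \<in> dom_D P M X" and H: "H \<in> dom_D P M X" and U: "U \<in> L2_proc P M X"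
  shows "dual_pairing P M X (\<lambda>\<omega>. c * F \<omega> + d * H \<omega>) U
    = c * dual_pairing P M X F U + d * dual_pairing P M X H U"
proof -
  have int: "integrable P (\<lambda>\<omega>. D A k \<omega> * U k \<omega>)" if "A \<in> dom_D P M X" for A k
    by (intro L2_space_mult L2_proc_L2 D_L2_proc U that)
  have meas: "D A k \<in> borel_measurable P" if "A \<in> dom_D P M X" for A k
    by (intro D_measurable_P L2_space_measurable dom_D_L2 that)
  note [measurable] = meas[OF F] meas[OF H] meas[OF dom_D_lin[OF F H]] L2_space_measurable[OF L2_proc_L2[OF U]]
  have "(\<integral>\<omega>. D (\<lambda>\<omega>. c * F \<omega> + d * H \<omega>) k \<omega> * U k \<omega> \<partial>P)
      = c * (\<integral>\<omega>. D F k \<omega> * U k \<omega> \<partial>P) + d * (\<integral>\<omega>. D H k \<omega> * U k \<omega> \<partial>P)" for k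
  proof -
    have "(\<integral>\<omega>. D (\<lambda>\<omega>. c * F \<omega> + d * H \<omega>) k \<omega> * U k \<omega> \<partial>P)
        = (\<integral>\<omega>. c * (D F k \<omega> * U k \<omega>) + d * (D H k \<omega> * U k \<omega>) \<partial>P)"
    proof (rule integral_cong_AE)
      show "AE \<omega> in P. D (\<lambda>\<omega>. c * F \<omega> + d * H \<omega>) k \<omega> * U k \<omega>
          = c * (D F k \<omega> * U k \<omega>) + d * (D H k \<omega> * U k \<omega>)"
        using D_lin[OF dom_D_L2[OF F] dom_D_L2[OF H], of c d k]
        by eventually_elim (simp add: algebra_simps)
    qed simp_all
    then show ?thesis using int[OF F] int[OF H] by simp
  qed
  then show ?thesis
    unfolding dual_pairing_def
    using summable_pairing[OF D_L2_proc[OF F] U] summable_pairing[OF D_L2_proc[OF H] U]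
    by (simp add: suminf_add[symmetric] suminf_mult[symmetric] summable_mult)
qed

text \<open>\<open>delta\<close> is a choice, so a function with the two properties must be shown to
  exist. Riesz is applied on \<open>P_F P M X\<close> in order that the representing function be
  sigma(X)-measurable.\<close>

lemma
  assumes U: "U \<in> dom_delta P M X"
  shows delta_L2_X: "delta P M X U \<in> L2_X P M X"
    and integral_mult_delta: "F \<in> dom_D P M X \<Longrightarrow> (\<integral>\<omega>. F \<omega> * delta P M X U \<omega> \<partial>P) = dual_pairing P M X F U"
proof -
  interpret F: prob_space "P_F P M X" by (rule prob_space_P_F)
  obtain C where UL2: "U \<in> L2_proc P M X"
    and C: "\<And>F. F \<in> dom_D P M X \<Longrightarrow> \<bar>dual_pairing P M X F U\<bar> \<le> C * L2_nrm P F"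
    using U by (auto simp: dom_delta_def)
  have meas: "F \<in> borel_measurable (\<G> UNIV)" if "F \<in> L2_X P M X" for F
    using that by (simp add: L2_X_iff)
  have "\<exists>V \<in> L2_space (P_F P M X). \<forall>F \<in> dom_D P M X.
      (\<integral>\<omega>. F \<omega> * V \<omega> \<partial>P_F P M X) = dual_pairing P M X F U"
  proof (rule F.L2_riesz_representation)
    show "dom_D P M X \<subseteq> L2_space (P_F P M X)"
      using dom_D_L2_X unfolding L2_X_def by blast
    have "(\<lambda>_. 0) \<in> cyl_S P M X" by (auto simp: cyl_S_iff L2_space_def)
    then show "dom_D P M X \<noteq> {}" using cyl_S_subset_dom_D by blast
    show "\<bar>dual_pairing P M X F U\<bar> \<le> C * L2_nrm (P_F P M X) F" if "F \<in> dom_D P M X" for F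
      using C[OF that] L2_nrm_P_F[OF meas[OF dom_D_L2_X[OF that]]] by simp
  qed (intro dom_D_lin dual_pairing_lin UL2; assumption)+
  then obtain V where V: "V \<in> L2_X P M X"
    and "\<And>F. F \<in> dom_D P M X \<Longrightarrow> (\<integral>\<omega>. F \<omega> * V \<omega> \<partial>P_F P M X) = dual_pairing P M X F U"
    unfolding L2_X_def by blast
  moreover have "(\<integral>\<omega>. F \<omega> * V \<omega> \<partial>P_F P M X) = (\<integral>\<omega>. F \<omega> * V \<omega> \<partial>P)" if "F \<in> dom_D P M X" for F
    by (intro integral_P_F borel_measurable_times meas V dom_D_L2_X that)
  ultimately have "\<exists>V. V \<in> L2_X P M X \<and> (\<forall>F \<in> dom_D P M X. (\<integral>\<omega>. F \<omega> * V \<omega> \<partial>P) = dual_pairing P M X F U)"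
    by (intro exI[of _ V]) simp
  from someI_ex[OF this] show "delta P M X U \<in> L2_X P M X"
    "F \<in> dom_D P M X \<Longrightarrow> (\<integral>\<omega>. F \<omega> * delta P M X U \<omega> \<partial>P) = dual_pairing P M X F U"
    unfolding delta_def by blast+
qed

subsection \<open>The two carre-du-champ operators\<close>

text \<open>A \<pi>-\<lambda> argument: the sets depending on finitely many coordinates are stable
  under intersection and generate sigma(X), while the sets over which u - v integrates to 0 form a
  Dynkin system.\<close>

lemma AE_eq_of_cylinder_integrals:
  assumes u: "u \<in> borel_measurable (\<G> UNIV)" "integrable P u"
    and v: "v \<in> borel_measurable (\<G> UNIV)" "integrable P v"
    and eq: "\<And>m A. A \<in> sets (\<G> {..m}) \<Longrightarrow>
      (\<integral>\<omega>. indicator A \<omega> * u \<omega> \<partial>P) = (\<integral>\<omega>. indicator A \<omega> * v \<omega> \<partial>P)"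
  shows "AE \<omega> in P. u \<omega> = (v \<omega> :: real)"
proof -
  define w where "w \<omega> = u \<omega> - v \<omega>" for \<omega>
  define E where "E = (\<Union>m. sets (\<G> {..m}))"
  have w [measurable]: "integrable P w" and wG: "w \<in> borel_measurable (\<G> UNIV)"
    using u v by (simp_all add: w_def[abs_def])
  have intA: "integrable P (\<lambda>\<omega>. indicator A \<omega> * w \<omega>)" if "A \<in> sets P" for A
    using integrable_mult_indicator[OF that w] by simp
  have sub: "A \<in> sets P" if "A \<in> sets (\<G> J)" for A J
    using that subalgebra_G[of J] by (auto simp: subalgebra_def)
  have E_zero: "(\<integral>\<omega>. indicator A \<omega> * w \<omega> \<partial>P) = 0" if "A \<in> sets (\<G> {..m})" for A m
    using eq[OF that] integrable_mult_indicator[OF sub[OF that] u(2)] integrable_mult_indicator[OF sub[OF that] v(2)]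
    by (simp add: w_def right_diff_distrib)
  have E_sub: "E \<subseteq> sets (\<G> UNIV)" unfolding E_def using sets_G_mono[OF subset_UNIV] by blast
  have "sets (\<G> UNIV) \<subseteq> sigma_sets (space P) E"
    unfolding sets_G[of UNIV]
  proof (rule sigma_sets_mono')
    show "{(\<lambda>\<omega>. X \<omega> j) -` A \<inter> space P |j A. j \<in> UNIV \<and> A \<in> sets (M j)} \<subseteq> E"
    proof safe
      fix j A assume "A \<in> sets (M j)"
      then have "(\<lambda>\<omega>. X \<omega> j) -` A \<inter> space P \<in> sets (\<G> {..j})"
        unfolding sets_G by (intro sigma_sets.Basic) auto
      then show "(\<lambda>\<omega>. X \<omega> j) -` A \<inter> space P \<in> E" unfolding E_def by blast
    qed
  qed
  \<comment> \<open>Membership is carried through the induction to keep the indicator measurable in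
    the complement and union steps.\<close>
  moreover have "A \<in> sets (\<G> UNIV) \<and> (\<integral>\<omega>. indicator A \<omega> * w \<omega> \<partial>P) = 0"
    if "A \<in> sigma_sets (space P) E" for A
  proof (rule sigma_sets_induct_disjoint[OF _ _ that])
    show "Int_stable E"
    proof (rule Int_stableI)
      fix a b assume "a \<in> E" "b \<in> E"
      then obtain m n where "a \<in> sets (\<G> {..m})" "b \<in> sets (\<G> {..n})" unfolding E_def by blast
      then have "a \<in> sets (\<G> {..max m n})" "b \<in> sets (\<G> {..max m n})"
        using sets_G_mono[of "{..m}" "{..max m n}"] sets_G_mono[of "{..n}" "{..max m n}"] by auto
      then show "a \<inter> b \<in> E" unfolding E_def by blast
    qed
    show "E \<subseteq> Pow (space P)" using E_sub sets.space_closed[of "\<G> UNIV"] by simp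
  next
    fix A assume "A \<in> E"
    then show "A \<in> sets (\<G> UNIV) \<and> (\<integral>\<omega>. indicator A \<omega> * w \<omega> \<partial>P) = 0"
      using E_zero E_sub unfolding E_def by blast
  next
    show "{} \<in> sets (\<G> UNIV) \<and> (\<integral>\<omega>. indicator {} \<omega> * w \<omega> \<partial>P) = 0" by simp
  next
    fix A assume A: "A \<in> sets (\<G> UNIV) \<and> (\<integral>\<omega>. indicator A \<omega> * w \<omega> \<partial>P) = 0"
    \<comment> \<open>The whole space is itself such a set, so w has integral 0; this yields the
      complement step.\<close>
    have top: "space P \<in> sets (\<G> {..0})" using sets.top[of "\<G> {..0}"] by simp
    have "(\<integral>\<omega>. indicator (space P - A) \<omega> * w \<omega> \<partial>P)
        = (\<integral>\<omega>. indicator (space P) \<omega> * w \<omega> - indicator A \<omega> * w \<omega> \<partial>P)"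
      by (intro Bochner_Integration.integral_cong) (auto split: split_indicator)
    also have "\<dots> = 0"
      using A E_zero[OF top] intA[OF sub[OF top]] intA[of A] sub[of A UNIV] by simp
    finally show "space P - A \<in> sets (\<G> UNIV) \<and> (\<integral>\<omega>. indicator (space P - A) \<omega> * w \<omega> \<partial>P) = 0"
      using A sets.compl_sets[of A "\<G> UNIV"] by simp
  next
    fix A :: "nat \<Rightarrow> 'w set"
    assume disj: "disjoint_family A" and A: "\<And>i. A i \<in> sets (\<G> UNIV) \<and> (\<integral>\<omega>. indicator (A i) \<omega> * w \<omega> \<partial>P) = 0"
    have un: "(\<Union>i. A i) \<in> sets (\<G> UNIV)" using A by blast
    have "(\<integral>\<omega>\<in>(\<Union>i. A i). w \<omega> \<partial>P) = (\<Sum>i. \<integral>\<omega>\<in>A i. w \<omega> \<partial>P)"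
    proof (rule lebesgue_integral_countable_add)
      show "A i \<in> sets P" for i using A sub by blast
      show "i \<noteq> j \<Longrightarrow> A i \<inter> A j = {}" for i j using disj by (auto simp: disjoint_family_on_def)
      show "set_integrable P (\<Union>i. A i) w"
        using intA[OF sub[OF un]] by (simp add: set_integrable_def)
    qed
    also have "\<dots> = 0" using A by (simp add: set_lebesgue_integral_def)
    finally show "(\<Union>i. A i) \<in> sets (\<G> UNIV) \<and> (\<integral>\<omega>. indicator (\<Union>i. A i) \<omega> * w \<omega> \<partial>P) = 0"
      using un by (simp add: set_lebesgue_integral_def)
  qed
  ultimately have zero: "(\<integral>\<omega>. indicator A \<omega> * w \<omega> \<partial>P) = 0" if "A \<in> sets (\<G> UNIV)" for A
    using that by blast
  have "AE \<omega> in P_F P M X. w \<omega> = 0"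
  proof (rule density_unique_real)
    show "integrable (P_F P M X) w" using w wG by (simp add: integrable_P_F_iff)
    fix A assume "A \<in> sets (P_F P M X)"
    then have A: "A \<in> sets (\<G> UNIV)" by (simp add: sets_P_F)
    have "(\<integral>\<omega>\<in>A. w \<omega> \<partial>P_F P M X) = (\<integral>\<omega>. indicator A \<omega> * w \<omega> \<partial>P)"
      unfolding set_lebesgue_integral_def using A wG by (subst integral_P_F) simp_all
    then show "(\<integral>\<omega>\<in>A. w \<omega> \<partial>P_F P M X) = (\<integral>\<omega>\<in>A. 0 \<partial>P_F P M X)"
      using zero[OF A] by (simp add: set_lebesgue_integral_def)
  qed simp
  then have "AE \<omega> in P. w \<omega> = 0"
    unfolding P_F_def by (rule AE_restr_to_subalg[OF subalgebra_G])
  then show ?thesis by (simp add: w_def)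
qed

text \<open>The defect of the Leibniz rule in coordinate k, tested against the indicator of A. Each
  expectation on the left is half of an integral over \<open>Q k\<close>; their combination has
  integrand (h + h') \<phi>, and exchangeability shows that both summands have the same
  integral.\<close>

lemma integral_D_leibniz:
  assumes F: "F \<in> L2_space P" and K: "K \<in> L2_space P" and FK: "(\<lambda>\<omega>. F \<omega> * K \<omega>) \<in> L2_space P"
    and f: "representative P M X F f" and g: "representative P M X K g" and A: "A \<in> sets (\<G> UNIV)"
  shows "(\<integral>\<omega>. D (\<lambda>\<omega>. indicator A \<omega> * K \<omega>) k \<omega> * D F k \<omega> \<partial>P)
      + (\<integral>\<omega>. D (\<lambda>\<omega>. indicator A \<omega> * F \<omega>) k \<omega> * D K k \<omega> \<partial>P)
      - (\<integral>\<omega>. D (indicator A) k \<omega> * D (\<lambda>\<omega>. F \<omega> * K \<omega>) k \<omega> \<partial>P)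
    = (\<integral>\<omega>. indicator A \<omega> * swap_prod X X' f g k \<omega> \<partial>P)"
proof -
  obtain B where B [measurable]: "B \<in> sets \<mu>" and AB: "A = X -` B \<inter> space P" using sets_GD[OF A] by blast
  define h :: "(nat \<Rightarrow> 'a) \<Rightarrow> real" where "h = indicator B"
  have AP: "indicator A \<in> borel_measurable P"
    using A subalgebra_G[of UNIV] by (auto simp: subalgebra_def)
  have hX: "indicator A \<omega> = h (X \<omega>)" if "\<omega> \<in> space P" for \<omega>
    using that by (simp add: h_def AB indicator_def)
  have AL2: "(indicator A :: 'w \<Rightarrow> real) \<in> L2_space P"
    by (rule Om.L2_space_bounded[OF AP, of 1]) (simp add: indicator_def)
  have AmL2: "(\<lambda>\<omega>. indicator A \<omega> * Y \<omega>) \<in> L2_space P" if "Y \<in> L2_space P" for Y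
    by (rule L2_space_bounded_mult[OF that AP, of 1]) (simp add: indicator_def)
  have fm [measurable]: "f \<in> borel_measurable \<mu>" "g \<in> borel_measurable \<mu>"
    and fAE: "AE \<omega> in P. F \<omega> = f (X \<omega>)" and gAE: "AE \<omega> in P. K \<omega> = g (X \<omega>)"
    using f g by (auto simp: representative_def L2_space_def)
  have [measurable]: "h \<in> borel_measurable \<mu>" unfolding h_def by simp
  have rFK: "representative P M X (\<lambda>\<omega>. F \<omega> * K \<omega>) (\<lambda>x. f x * g x)"
    by (rule representativeI[OF FK]) (measurable, use fAE gAE in eventually_elim, simp)
  have rA: "representative P M X (indicator A) h"
    by (rule representativeI[OF AL2]) (simp_all add: hX)
  have rAF: "representative P M X (\<lambda>\<omega>. indicator A \<omega> * F \<omega>) (\<lambda>x. h x * f x)"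
    by (rule representativeI[OF AmL2[OF F]]) (measurable, use fAE AE_space in eventually_elim, simp add: hX)
  have rAK: "representative P M X (\<lambda>\<omega>. indicator A \<omega> * K \<omega>) (\<lambda>x. h x * g x)"
    by (rule representativeI[OF AmL2[OF K]]) (measurable, use gAE AE_space in eventually_elim, simp add: hX)
  have L2\<mu>: "f \<in> L2_space \<mu>" "g \<in> L2_space \<mu>" "h \<in> L2_space \<mu>" "(\<lambda>x. f x * g x) \<in> L2_space \<mu>"
    "(\<lambda>x. h x * f x) \<in> L2_space \<mu>" "(\<lambda>x. h x * g x) \<in> L2_space \<mu>"
    using f g rA rFK rAF rAK by (simp_all add: representative_def)
  have diff: "(\<lambda>p. a (upd k p) - a (fst p)) \<in> L2_space (Q k)" if "a \<in> L2_space \<mu>" for a :: "_ \<Rightarrow> real"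
    by (intro L2_space_diff L2_upd L2_fst that)
  define \<phi> where "\<phi> p = (f (upd k p) - f (fst p)) * (g (upd k p) - g (fst p))" for p
  have [measurable]: "\<phi> \<in> borel_measurable (Q k)" unfolding \<phi>_def by measurable
  have \<phi>: "integrable (Q k) \<phi>"
    unfolding \<phi>_def by (intro L2_space_mult diff L2\<mu>)
  have h\<phi>: "integrable (Q k) (\<lambda>p. h (fst p) * \<phi> p)" "integrable (Q k) (\<lambda>p. h (upd k p) * \<phi> p)"
    by (rule Bochner_Integration.integrable_bound[OF \<phi>]; simp add: h_def indicator_def)+
  let ?I = "\<lambda>a b. \<integral>p. (a (upd k p) - a (fst p)) * (b (upd k p) - b (fst p)) \<partial>Q k"
  have "?I (\<lambda>x. h x * g x) f + ?I (\<lambda>x. h x * f x) g - ?I h (\<lambda>x. f x * g x)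
      = (\<integral>p. h (fst p) * \<phi> p + h (upd k p) * \<phi> p \<partial>Q k)"
  proof -
    have "?I (\<lambda>x. h x * g x) f + ?I (\<lambda>x. h x * f x) g - ?I h (\<lambda>x. f x * g x)
      = (\<integral>p. (h (upd k p) * g (upd k p) - h (fst p) * g (fst p)) * (f (upd k p) - f (fst p))
           + (h (upd k p) * f (upd k p) - h (fst p) * f (fst p)) * (g (upd k p) - g (fst p))
           - (h (upd k p) - h (fst p)) * (f (upd k p) * g (upd k p) - f (fst p) * g (fst p)) \<partial>Q k)"
      using L2_space_mult[OF diff[OF L2\<mu>(6)] diff[OF L2\<mu>(1)]]
        L2_space_mult[OF diff[OF L2\<mu>(5)] diff[OF L2\<mu>(2)]]
        L2_space_mult[OF diff[OF L2\<mu>(3)] diff[OF L2\<mu>(4)]] by simp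
    also have "\<dots> = (\<integral>p. h (fst p) * \<phi> p + h (upd k p) * \<phi> p \<partial>Q k)"
      by (intro Bochner_Integration.integral_cong refl) (simp add: \<phi>_def algebra_simps)
    finally show ?thesis .
  qed
  also have "\<dots> = (\<integral>p. h (fst p) * \<phi> p \<partial>Q k) + (\<integral>p. h (upd k p) * \<phi> p \<partial>Q k)"
    using h\<phi> by simp
  also have "(\<integral>p. h (upd k p) * \<phi> p \<partial>Q k) = (\<integral>p. h (fst p) * \<phi> p \<partial>Q k)"
  proof -
    \<comment> \<open>The exchange flips the sign of both differences in \<phi>, so \<phi> is
      unchanged while h' becomes h.\<close>
    have "(\<lambda>p. h (upd k p) * \<phi> p) = (\<lambda>p. (\<lambda>p. h (fst p) * \<phi> p) (upd k p, fst p k))"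
      by (auto simp: \<phi>_def fun_upd_idem algebra_simps)
    then show ?thesis
      using integral_Q_swap[of "\<lambda>p. h (fst p) * \<phi> p" k] by simp
  qed
  also have "(\<integral>p. h (fst p) * \<phi> p \<partial>Q k) = (\<integral>\<omega>. h (X \<omega>) * swap_prod X X' f g k \<omega> \<partial>P)"
    unfolding \<phi>_def by (rule integral_swap_prod[OF L2\<mu>(1,2), symmetric]) simp
  also have "(\<integral>\<omega>. h (X \<omega>) * swap_prod X X' f g k \<omega> \<partial>P) = (\<integral>\<omega>. indicator A \<omega> * swap_prod X X' f g k \<omega> \<partial>P)"
    by (intro Bochner_Integration.integral_cong) (simp_all add: hX)
  finally have "?I (\<lambda>x. h x * g x) f + ?I (\<lambda>x. h x * f x) g - ?I h (\<lambda>x. f x * g x)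
      = (\<integral>\<omega>. indicator A \<omega> * swap_prod X X' f g k \<omega> \<partial>P)
        + (\<integral>\<omega>. indicator A \<omega> * swap_prod X X' f g k \<omega> \<partial>P)" .
  moreover note integral_D_mult[OF L2_space_measurable[OF AmL2[OF K]] L2_space_measurable[OF F] rAK f, of k]
    integral_D_mult[OF L2_space_measurable[OF AmL2[OF F]] L2_space_measurable[OF K] rAF g, of k]
    integral_D_mult[OF AP L2_space_measurable[OF FK] rA rFK, of k]
  ultimately show ?thesis by linarith
qed

section \<open>Integrability of \<Gamma>_0 and its comparison with \<Gamma>\<close>

lemma integrable_Gam0_term:
  assumes "f \<in> L2_space \<mu>" "g \<in> L2_space \<mu>"
  shows "integrable P (Gam0_term P M X X' f g k)"
  unfolding Gam0_term_def by (rule \<G>.real_cond_exp_int(1)[OF integrable_swap_prod[OF assms]])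

text \<open>Testing with the sign of the term, which is sigma(X)-measurable, shows that conditioning
  contracts the L1 norm. Then |a b| \<le> a^2 + b^2 separates the two differences, and the factor 2
  comes from E[(f' - f)^2] = 2 E[(D_k f(X))^2].\<close>

lemma integral_abs_Gam0_term_le:
  assumes f: "f \<in> L2_space \<mu>" and g: "g \<in> L2_space \<mu>"
  shows "(\<integral>\<omega>. \<bar>Gam0_term P M X X' f g k \<omega>\<bar> \<partial>P)
    \<le> 2 * (\<integral>\<omega>. (D (\<lambda>\<omega>. f (X \<omega>)) k \<omega>)\<^sup>2 \<partial>P) + 2 * (\<integral>\<omega>. (D (\<lambda>\<omega>. g (X \<omega>)) k \<omega>)\<^sup>2 \<partial>P)"
proof -
  let ?T = "Gam0_term P M X X' f g k" and ?s = "swap_prod X X' f g k"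
  have s: "integrable P ?s" by (rule integrable_swap_prod[OF f g])
  have sgn: "(\<lambda>\<omega>. sgn (?T \<omega>)) \<in> borel_measurable (\<G> UNIV)"
    unfolding Gam0_term_def by (rule measurable_compose[OF borel_measurable_cond_exp]) simp
  have sgns: "integrable P (\<lambda>\<omega>. sgn (?T \<omega>) * ?s \<omega>)"
    by (rule Bochner_Integration.integrable_bound[OF s])
      (use measurable_G_P[OF sgn] s in \<open>auto simp: abs_mult sgn_if\<close>)
  have "(\<integral>\<omega>. \<bar>?T \<omega>\<bar> \<partial>P) = (\<integral>\<omega>. sgn (?T \<omega>) * ?T \<omega> \<partial>P)"
    by (intro Bochner_Integration.integral_cong) (simp_all add: abs_sgn mult.commute)
  also have "\<dots> = (\<integral>\<omega>. sgn (?T \<omega>) * ?s \<omega> \<partial>P)"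
    using \<G>.real_cond_exp_intg(2)[OF sgns sgn borel_measurable_integrable[OF s]]
    unfolding Gam0_term_def .
  also have "\<dots> \<le> (\<integral>\<omega>. \<bar>?s \<omega>\<bar> \<partial>P)"
    by (intro integral_mono sgns integrable_abs s) (auto simp: sgn_if)
  also have "\<dots> = (\<integral>\<omega>. \<bar>(f ((X \<omega>)(k := X' \<omega> k)) - f (X \<omega>)) * (g ((X \<omega>)(k := X' \<omega> k)) - g (X \<omega>))\<bar> \<partial>P)"
    by (simp add: swap_prod_def)
  also have "\<dots> \<le> (\<integral>\<omega>. (f ((X \<omega>)(k := X' \<omega> k)) - f (X \<omega>))\<^sup>2 \<partial>P) + (\<integral>\<omega>. (g ((X \<omega>)(k := X' \<omega> k)) - g (X \<omega>))\<^sup>2 \<partial>P)"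
  proof (rule integral_mult_le_squares)
    have "(\<lambda>\<omega>. (\<lambda>p. a (upd k p) - a (fst p)) (X \<omega>, X' \<omega> k)) \<in> L2_space P"
      if "a \<in> L2_space \<mu>" for a :: "_ \<Rightarrow> real"
      by (rule L2_space_compose[OF measurable_pair_X_X' distr_X_X'])
        (intro L2_space_diff L2_upd L2_fst that)
    from this[OF f] this[OF g]
    show "(\<lambda>\<omega>. f ((X \<omega>)(k := X' \<omega> k)) - f (X \<omega>)) \<in> L2_space P"
      "(\<lambda>\<omega>. g ((X \<omega>)(k := X' \<omega> k)) - g (X \<omega>)) \<in> L2_space P" by simp_all
  qed
  also have "\<dots> = 2 * (\<integral>\<omega>. (D (\<lambda>\<omega>. f (X \<omega>)) k \<omega>)\<^sup>2 \<partial>P) + 2 * (\<integral>\<omega>. (D (\<lambda>\<omega>. g (X \<omega>)) k \<omega>)\<^sup>2 \<partial>P)"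
  proof -
    have "(\<integral>\<omega>. (a ((X \<omega>)(k := X' \<omega> k)) - a (X \<omega>))\<^sup>2 \<partial>P) = 2 * (\<integral>\<omega>. (D (\<lambda>\<omega>. a (X \<omega>)) k \<omega>)\<^sup>2 \<partial>P)"
      if a: "a \<in> L2_space \<mu>" for a
      using integral_swap_prod[OF a a, of "\<lambda>_. 1" k] integral_D_mult_comp[OF a a, of k]
      by (simp add: swap_prod_def power2_eq_square)
    from this[OF f] this[OF g] show ?thesis by simp
  qed
  finally show ?thesis .
qed

lemma summable_integral_abs_Gam0_term:
  assumes F: "F \<in> dom_D P M X" and K: "K \<in> dom_D P M X"
    and f: "representative P M X F f" and g: "representative P M X K g"
  shows "summable (\<lambda>k. \<integral>\<omega>. \<bar>Gam0_term P M X X' f g k \<omega>\<bar> \<partial>P)"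
proof (rule summable_comparison_test')
  show "summable (\<lambda>k. 2 * (\<integral>\<omega>. (D F k \<omega>)\<^sup>2 \<partial>P) + 2 * (\<integral>\<omega>. (D K k \<omega>)\<^sup>2 \<partial>P))"
    by (intro summable_add summable_mult summable_L2_proc D_L2_proc F K)
  have "(\<integral>\<omega>. (D (\<lambda>\<omega>. a (X \<omega>)) k \<omega>)\<^sup>2 \<partial>P) = (\<integral>\<omega>. (D A k \<omega>)\<^sup>2 \<partial>P)"
    if A: "A \<in> dom_D P M X" and a: "representative P M X A a" for A a k
  proof (rule integral_cong_AE)
    have Am: "A \<in> borel_measurable P" "(\<lambda>\<omega>. a (X \<omega>)) \<in> borel_measurable P"
      using a by (auto intro!: L2_space_measurable dom_D_L2[OF A] L2_X_comp simp: representative_def)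
    show "(\<lambda>\<omega>. (D (\<lambda>\<omega>. a (X \<omega>)) k \<omega>)\<^sup>2) \<in> borel_measurable P" "(\<lambda>\<omega>. (D A k \<omega>)\<^sup>2) \<in> borel_measurable P"
      by (intro borel_measurable_power D_measurable_P Am)+
    have "AE \<omega> in P. D A k \<omega> = D (\<lambda>\<omega>. a (X \<omega>)) k \<omega>"
      using a by (intro D_cong Am) (simp add: representative_def)
    then show "AE \<omega> in P. (D (\<lambda>\<omega>. a (X \<omega>)) k \<omega>)\<^sup>2 = (D A k \<omega>)\<^sup>2"
      by eventually_elim simp
  qed
  from this[OF F f] this[OF K g]
  show "norm (\<integral>\<omega>. \<bar>Gam0_term P M X X' f g k \<omega>\<bar> \<partial>P)
      \<le> 2 * (\<integral>\<omega>. (D F k \<omega>)\<^sup>2 \<partial>P) + 2 * (\<integral>\<omega>. (D K k \<omega>)\<^sup>2 \<partial>P)" for k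
    using integral_abs_Gam0_term_le[of f g k] f g by (simp add: representative_def)
qed

context
  fixes F K f g
  assumes F: "F \<in> dom_D P M X" and K: "K \<in> dom_D P M X"
    and f: "representative P M X F f" and g: "representative P M X K g"
begin

lemma L2_fg: "f \<in> L2_space \<mu>" "g \<in> L2_space \<mu>"
  using f g by (simp_all add: representative_def)

lemma AE_summable_Gam0_term: "AE \<omega> in P. summable (\<lambda>k. \<bar>Gam0_term P M X X' f g k \<omega>\<bar>)"
  by (intro AE_summable_of_summable_integral integrable_Gam0_term L2_fg summable_integral_abs_Gam0_term[OF F K f g])

lemma integrable_Gam0: "integrable P (Gam0 P M X X' f g)"
  unfolding Gam0_def[abs_def]
  by (intro integrable_divide integrable_suminf integrable_Gam0_term L2_fg)
    (simp_all add: AE_summable_Gam0_term summable_integral_abs_Gam0_term[OF F K f g])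

lemma Gam0_measurable: "Gam0 P M X X' f g \<in> borel_measurable (\<G> UNIV)"
  unfolding Gam0_def[abs_def] Gam0_term_def
  by (intro borel_measurable_divide borel_measurable_suminf borel_measurable_cond_exp) simp

text \<open>Summability of the L1 norms allows integrating term by term, and the conditional
  expectation in each term drops out because A belongs to sigma(X).\<close>

lemma integral_indicator_Gam0:
  assumes A: "A \<in> sets (\<G> UNIV)"
  shows "(\<integral>\<omega>. indicator A \<omega> * Gam0 P M X X' f g \<omega> \<partial>P)
    = (\<Sum>k. \<integral>\<omega>. indicator A \<omega> * swap_prod X X' f g k \<omega> \<partial>P) / 2"
proof -
  let ?T = "Gam0_term P M X X' f g" and ?s = "swap_prod X X' f g"
  have AP: "A \<in> sets P" using A subalgebra_G[of UNIV] by (auto simp: subalgebra_def)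
  have int: "integrable P (\<lambda>\<omega>. indicator A \<omega> * ?T k \<omega>)" for k
    using integrable_mult_indicator[OF AP integrable_Gam0_term[OF L2_fg, of k]] by simp
  have abs: "\<bar>indicator A \<omega> * ?T k \<omega>\<bar> \<le> \<bar>?T k \<omega>\<bar>" for k \<omega>
    by (simp add: indicator_def)
  have "(\<integral>\<omega>. (\<Sum>k. indicator A \<omega> * ?T k \<omega>) \<partial>P) = (\<Sum>k. \<integral>\<omega>. indicator A \<omega> * ?T k \<omega> \<partial>P)"
  proof (rule integral_suminf[OF int])
    show "AE \<omega> in P. summable (\<lambda>k. norm (indicator A \<omega> * ?T k \<omega>))"
      using AE_summable_Gam0_term
      by eventually_elim (rule summable_comparison_test', assumption, use abs in simp)
    show "summable (\<lambda>k. \<integral>\<omega>. norm (indicator A \<omega> * ?T k \<omega>) \<partial>P)"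
    proof (rule summable_comparison_test'[OF summable_integral_abs_Gam0_term[OF F K f g]])
      show "norm (\<integral>\<omega>. norm (indicator A \<omega> * ?T k \<omega>) \<partial>P) \<le> (\<integral>\<omega>. \<bar>?T k \<omega>\<bar> \<partial>P)" for k
        using integral_mono[OF integrable_abs[OF int] integrable_abs[OF integrable_Gam0_term[OF L2_fg]] abs, of k]
        by simp
    qed
  qed
  also have "\<dots> = (\<Sum>k. \<integral>\<omega>. indicator A \<omega> * ?s k \<omega> \<partial>P)"
  proof (rule suminf_cong)
    show "(\<integral>\<omega>. indicator A \<omega> * ?T k \<omega> \<partial>P) = (\<integral>\<omega>. indicator A \<omega> * ?s k \<omega> \<partial>P)" for k
      unfolding Gam0_term_def
    proof (rule \<G>.real_cond_exp_intg(2))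
      show "integrable P (\<lambda>\<omega>. indicator A \<omega> * ?s k \<omega>)"
        using integrable_mult_indicator[OF AP integrable_swap_prod[OF L2_fg, of k]] by simp
      show "?s k \<in> borel_measurable P"
        by (rule borel_measurable_integrable[OF integrable_swap_prod[OF L2_fg]])
      show "indicator A \<in> borel_measurable (\<G> UNIV)" using A by simp
    qed
  qed
  \<comment> \<open>The indicator is 0 or 1, so it leaves the series at every point, even where the
    series diverges.\<close>
  also have "(\<integral>\<omega>. (\<Sum>k. indicator A \<omega> * ?T k \<omega>) \<partial>P) = (\<integral>\<omega>. 2 * (indicator A \<omega> * Gam0 P M X X' f g \<omega>) \<partial>P)"
    by (intro Bochner_Integration.integral_cong refl) (simp add: Gam0_def indicator_def)
  finally show ?thesis by simp
qed

end

text \<open>Tested against H, the three parts of \<Gamma> pair \<open>delta\<close> of D F, D K and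
  D (F K) with H K, H F and H. All three test functions lie in the domain of \<open>D\<close>, so
  only products of gradients remain and \<open>integral_D_leibniz\<close> applies for each
  k.\<close>

lemma Gam_eq_Gam0:
  assumes F: "F \<in> dom_L P M X" and K: "K \<in> dom_L P M X" and FK: "(\<lambda>\<omega>. F \<omega> * K \<omega>) \<in> dom_L P M X"
    and f: "representative P M X F f" and g: "representative P M X K g"
  shows "AE \<omega> in P. Gam P M X F K \<omega> = Gam0 P M X X' f g \<omega>"
proof -
  let ?FK = "\<lambda>\<omega>. F \<omega> * K \<omega>"
  have dom: "F \<in> dom_D P M X" "K \<in> dom_D P M X" "?FK \<in> dom_D P M X"
    and del: "D F \<in> dom_delta P M X" "D K \<in> dom_delta P M X" "D ?FK \<in> dom_delta P M X"
    using F K FK by (simp_all add: dom_L_def)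
  note L2 = dom[THEN dom_D_L2]
  define V where "V Y = delta P M X (D Y)" for Y
  have VX: "V F \<in> L2_X P M X" "V K \<in> L2_X P M X" "V ?FK \<in> L2_X P M X"
    unfolding V_def by (intro delta_L2_X del)+
  then have VL2: "V F \<in> L2_space P" "V K \<in> L2_space P" "V ?FK \<in> L2_space P"
    by (simp_all add: L2_X_iff)
  \<comment> \<open>The minus sign in L = - \<open>delta\<close> D reverses all three signs.\<close>
  have Gam: "Gam P M X F K = (\<lambda>\<omega>. (K \<omega> * V F \<omega> + F \<omega> * V K \<omega> - V ?FK \<omega>) / 2)"
    by (simp add: Gam_def[abs_def] OU_L_def V_def algebra_simps)
  show ?thesis
  proof (rule AE_eq_of_cylinder_integrals)
    show "Gam P M X F K \<in> borel_measurable (\<G> UNIV)"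
      using VX dom[THEN dom_D_L2_X] unfolding Gam L2_X_iff
      by (intro borel_measurable_divide borel_measurable_diff borel_measurable_add borel_measurable_times
          borel_measurable_const) simp_all
    show "integrable P (Gam P M X F K)"
      unfolding Gam
      by (intro integrable_divide Bochner_Integration.integrable_diff Bochner_Integration.integrable_add
          L2_space_mult L2 VL2 Om.L2_space_integrable)
    show "integrable P (Gam0 P M X X' f g)" by (rule integrable_Gam0[OF dom(1,2) f g])
    show "Gam0 P M X X' f g \<in> borel_measurable (\<G> UNIV)" by (rule Gam0_measurable[OF dom(1,2) f g])
    fix m A assume A: "A \<in> sets (\<G> {..m})"
    let ?H = "indicator A :: 'w \<Rightarrow> real"
    have HG: "?H \<in> borel_measurable (\<G> {..m})" using A by simp
    have H1: "\<bar>?H \<omega>\<bar> \<le> 1" for \<omega> by (simp add: indicator_def)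
    have HL2: "?H \<in> L2_space P" by (rule Om.L2_space_bounded[OF measurable_G_P[OF HG] H1])
    then have HD: "?H \<in> dom_D P M X"
      using HG by (intro cyl_S_subset_dom_D) (auto simp: cyl_S_iff)
    have HKD: "(\<lambda>\<omega>. ?H \<omega> * K \<omega>) \<in> dom_D P M X" and HFD: "(\<lambda>\<omega>. ?H \<omega> * F \<omega>) \<in> dom_D P M X"
      by (intro dom_D_bounded_mult[OF _ HG H1] dom)+
    have AU: "A \<in> sets (\<G> UNIV)" using A sets_G_mono[OF subset_UNIV] by blast
    have pair: "(\<integral>\<omega>. Y \<omega> * V Z \<omega> \<partial>P) = (\<Sum>k. \<integral>\<omega>. D Y k \<omega> * D Z k \<omega> \<partial>P)"
      if "Y \<in> dom_D P M X" "D Z \<in> dom_delta P M X" for Y Z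
      using integral_mult_delta[OF that(2,1)] by (simp add: V_def dual_pairing_def)
    have sm: "summable (\<lambda>k. \<integral>\<omega>. D Y k \<omega> * D Z k \<omega> \<partial>P)" if "Y \<in> dom_D P M X" "Z \<in> dom_D P M X" for Y Z
      by (intro summable_pairing D_L2_proc that)
    have "2 * (\<integral>\<omega>. ?H \<omega> * Gam P M X F K \<omega> \<partial>P)
        = (\<integral>\<omega>. (?H \<omega> * K \<omega>) * V F \<omega> + (?H \<omega> * F \<omega>) * V K \<omega> - ?H \<omega> * V ?FK \<omega> \<partial>P)"
      unfolding Gam integral_mult_right_zero[symmetric]
      by (intro Bochner_Integration.integral_cong refl) (simp add: field_simps)
    also have "\<dots> = (\<integral>\<omega>. (?H \<omega> * K \<omega>) * V F \<omega> \<partial>P) + (\<integral>\<omega>. (?H \<omega> * F \<omega>) * V K \<omega> \<partial>P) - (\<integral>\<omega>. ?H \<omega> * V ?FK \<omega> \<partial>P)"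
      using L2_space_mult[OF dom_D_L2[OF HKD] VL2(1)] L2_space_mult[OF dom_D_L2[OF HFD] VL2(2)]
        L2_space_mult[OF HL2 VL2(3)] by simp
    \<comment> \<open>The three pairings converge separately, so they merge into one series.\<close>
    also have "\<dots> = (\<Sum>k. (\<integral>\<omega>. D (\<lambda>\<omega>. ?H \<omega> * K \<omega>) k \<omega> * D F k \<omega> \<partial>P)
        + (\<integral>\<omega>. D (\<lambda>\<omega>. ?H \<omega> * F \<omega>) k \<omega> * D K k \<omega> \<partial>P) - (\<integral>\<omega>. D ?H k \<omega> * D ?FK k \<omega> \<partial>P))"
      unfolding pair[OF HKD del(1)] pair[OF HFD del(2)] pair[OF HD del(3)]
      using sm[OF HKD dom(1)] sm[OF HFD dom(2)] sm[OF HD dom(3)]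
      by (simp add: suminf_add suminf_diff summable_add)
    also have "\<dots> = (\<Sum>k. \<integral>\<omega>. ?H \<omega> * swap_prod X X' f g k \<omega> \<partial>P)"
      unfolding integral_D_leibniz[OF L2 f g AU] ..
    also have "\<dots> = 2 * (\<integral>\<omega>. ?H \<omega> * Gam0 P M X X' f g \<omega> \<partial>P)"
      using integral_indicator_Gam0[OF dom(1,2) f g AU] by simp
    finally show "(\<integral>\<omega>. ?H \<omega> * Gam P M X F K \<omega> \<partial>P) = (\<integral>\<omega>. ?H \<omega> * Gam0 P M X X' f g \<omega> \<partial>P)" by simp
  qed
qed

end

text \<open>Well-definedness is spelled out because \<open>real_cond_exp\<close> and the infinite
  sum are total functions: representatives exist, and for every choice of them the conditioned
  products are integrable, the series converges almost surely and its half-sum is integrable.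
  Quantifying over all \<open>f\<close> and \<open>g\<close> covers independence of that
  choice.\<close>

theorem proposition2p17:
  fixes P :: "'w measure" and M :: "nat \<Rightarrow> 'a measure"
    and X X' :: "'w \<Rightarrow> nat \<Rightarrow> 'a" and F G :: "'w \<Rightarrow> real"
  assumes "\<And>n. prob_space (M n)"
    and "prob_space P"
    and "prob_space.indep_var P (\<Pi>\<^sub>M n\<in>UNIV. M n) X (\<Pi>\<^sub>M n\<in>UNIV. M n) X'"
    and "distr P (\<Pi>\<^sub>M n\<in>UNIV. M n) X = (\<Pi>\<^sub>M n\<in>UNIV. M n)"
    and "distr P (\<Pi>\<^sub>M n\<in>UNIV. M n) X' = (\<Pi>\<^sub>M n\<in>UNIV. M n)"
    and "F \<in> dom_L P M X" and "G \<in> dom_L P M X"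
    and "(\<lambda>\<omega>. F \<omega> * G \<omega>) \<in> dom_L P M X"
  shows "(\<exists>f. representative P M X F f) \<and> (\<exists>g. representative P M X G g) \<and>
    (\<forall>f g. representative P M X F f \<longrightarrow> representative P M X G g \<longrightarrow>
       (\<forall>k. integrable P (swap_prod X X' f g k)) \<and>
       (AE \<omega> in P. summable (\<lambda>k. Gam0_term P M X X' f g k \<omega>)) \<and>
       integrable P (Gam0 P M X X' f g) \<and>
       (AE \<omega> in P. Gam P M X F G \<omega> = Gam0 P M X X' f g \<omega>))"
proof -
  interpret M: prob_space "M n" for n by fact
  interpret Om: prob_space P by fact
  interpret indep_copies M P X X'
    by unfold_locales (fact assms)+
  have dom: "F \<in> dom_D P M X" "G \<in> dom_D P M X"
    using assms by (simp_all add: dom_L_def)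
  show ?thesis
  proof (intro conjI allI impI)
    show "\<exists>f. representative P M X F f" "\<exists>g. representative P M X G g"
      by (intro representative_exists dom_D_L2_X dom)+
    fix f g assume f: "representative P M X F f" and g: "representative P M X G g"
    show "integrable P (swap_prod X X' f g k)" for k
      using f g by (intro integrable_swap_prod) (simp_all add: representative_def)
    show "AE \<omega> in P. summable (\<lambda>k. Gam0_term P M X X' f g k \<omega>)"
      using AE_summable_Gam0_term[OF dom f g] by eventually_elim (rule summable_rabs_cancel)
    show "integrable P (Gam0 P M X X' f g)" by (rule integrable_Gam0[OF dom f g])
    show "AE \<omega> in P. Gam P M X F G \<omega> = Gam0 P M X X' f g \<omega>"
      by (rule Gam_eq_Gam0[OF assms(6-8) f g])
  qed
qed

end
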